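(* For every $d\ge3$ there exists a constant $C_{d,2^*}>0$, depending only on $d$, such that for every $\varepsilon>0$ the following inequalities hold: $$\sum_{\mathrm v\in\mathbb V^d_\varepsilon}|\hat u(\mathrm v)|^{2^*}\le C_{d,2^*}\left(\varepsilon^{1/2}\|u'\|_{L^2(\mathcal G^d_\varepsilon)}\right)^{2^*}\qquad\text{for all }u\in H^1(\mathcal G^d_\varepsilon),$$ and $$\|u\|_{L^\infty(\mathcal G^d_\varepsilon)}\le\left(C_{d,2^*}^{1/2^*}+2^{-1/2}\right)\varepsilon^{1/2}\|u'\|_{L^2(\mathcal G^d_\varepsilon)}\qquad\text{for all }u\in H^1(\mathcal G^d_\varepsilon).$$
   Context: $2^*=\frac{2d}{d-2}$. $\mathbb V^d_\varepsilon=\varepsilon\mathbb Z^d$. The metric grid $\mathcal G^d_\varepsilon$ is the metric graph (subset of $\mathbb R^d$) with vertex set $\varepsilon\mathbb Z^d$ and an edge, identified with $[0,\varepsilon]$, between every two vertices at distance $\varepsilon$. $L^p(\mathcal G^d_\varepsilon)$ is with respect to one-dimensional Lebesgue measure on the edges. $H^1(\mathcal G^d_\varepsilon)$ is the space of continuous $u:\mathcal G^d_\varepsilon\to\mathbb R$ whose restriction to every edge is in $H^1([0,\varepsilon])$ and with $\|u'\|^2_{L^2(\mathcal G^d_\varepsilon)}+\|u\|^2_{L^2(\mathcal G^d_\varepsilon)}<\infty$. For such $u$, $\hat u=u|_{\mathbb V^d_\varepsilon}$. *)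

theory Defs
  imports "HOL-Analysis.Analysis" "HOL-Probability.Essential_Supremum"
begin

definition sq_integrable :: "'a measure \<Rightarrow> ('a \<Rightarrow> real) \<Rightarrow> bool" where
  "sq_integrable M f \<longleftrightarrow> f \<in> borel_measurable M \<and> integrable M (\<lambda>x. (f x)\<^sup>2)"

definition L2norm :: "'a measure \<Rightarrow> ('a \<Rightarrow> real) \<Rightarrow> real" where
  "L2norm M f = sqrt (\<integral>x. (f x)\<^sup>2 \<partial>M)"

definition Linf_norm :: "'a measure \<Rightarrow> ('a \<Rightarrow> real) \<Rightarrow> ennreal" where
  "Linf_norm M f = esssup M (\<lambda>x. ennreal \<bar>f x\<bar>)"

definition test_functions :: "real \<Rightarrow> (real \<Rightarrow> real) set" where
  "test_functions l = {\<phi>. (\<forall>n x. (deriv ^^ n) \<phi> differentiable (at x))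
     \<and> compact (closure {x. \<phi> x \<noteq> 0}) \<and> closure {x. \<phi> x \<noteq> 0} \<subseteq> {0<..<l}}"

text \<open>\<open>g\<close> is a square-integrable weak derivative of \<open>f\<close> on \<open>[0, l]\<close>; both are regarded as functions
  on \<open>[0, l]\<close>, and their values elsewhere play no role.\<close>

definition has_weak_deriv :: "real \<Rightarrow> (real \<Rightarrow> real) \<Rightarrow> (real \<Rightarrow> real) \<Rightarrow> bool" where
  "has_weak_deriv l f g \<longleftrightarrow> sq_integrable (lebesgue_on {0..l}) g \<and>
     (\<forall>\<phi>\<in>test_functions l.
        (\<integral>t. f t * deriv \<phi> t \<partial>lebesgue_on {0..l}) = - (\<integral>t. g t * \<phi> t \<partial>lebesgue_on {0..l}))"

definition H1_interval :: "real \<Rightarrow> (real \<Rightarrow> real) set" where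
  "H1_interval l = {f. sq_integrable (lebesgue_on {0..l}) f \<and> (\<exists>g. has_weak_deriv l f g)}"

text \<open>The weak derivative is unique up to a null set, so the choice of representative does not
  affect any norm.\<close>

definition weak_deriv :: "real \<Rightarrow> (real \<Rightarrow> real) \<Rightarrow> real \<Rightarrow> real" where
  "weak_deriv l f = (SOME g. has_weak_deriv l f g)"

definition grid_vertices :: "real \<Rightarrow> (real ^ 'n) set" where
  "grid_vertices \<epsilon> = {\<epsilon> *\<^sub>R k | k. \<forall>i. k $ i \<in> \<int>}"

text \<open>Two vertices at distance \<open>\<epsilon>\<close> differ by \<open>\<plusminus>\<epsilon>\<close> in exactly one coordinate, so they are comparable
  in the componentwise order. The condition \<open>v \<le> w\<close> thus merely picks one orientation of each
  edge; the norms do not depend on it.\<close>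

definition grid_edges :: "real \<Rightarrow> ((real ^ 'n) \<times> (real ^ 'n)) set" where
  "grid_edges \<epsilon> = {(v, w). v \<in> grid_vertices \<epsilon> \<and> w \<in> grid_vertices \<epsilon> \<and> dist v w = \<epsilon> \<and> v \<le> w}"

definition metric_grid :: "real \<Rightarrow> (real ^ 'n) set" where
  "metric_grid \<epsilon> = grid_vertices \<epsilon> \<union> (\<Union>(v, w)\<in>grid_edges \<epsilon>. closed_segment v w)"

text \<open>Each edge is identified with \<open>[0, \<epsilon>]\<close>. Functions on the grid are integrated in these edge
  coordinates, that is, over the disjoint union of the edges. A vertex then occurs once for every
  edge containing it, but these points form a null set.\<close>

definition edge_point :: "real \<Rightarrow> (real ^ 'n) \<times> (real ^ 'n) \<Rightarrow> real \<Rightarrow> real ^ 'n" where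
  "edge_point \<epsilon> e t = fst e + (t / \<epsilon>) *\<^sub>R (snd e - fst e)"

definition grid_measure :: "real \<Rightarrow> (((real ^ 'n) \<times> (real ^ 'n)) \<times> real) measure" where
  "grid_measure \<epsilon> = count_space (grid_edges \<epsilon>) \<Otimes>\<^sub>M lebesgue_on {0..\<epsilon>}"

definition on_edges :: "real \<Rightarrow> (real ^ 'n \<Rightarrow> real) \<Rightarrow> ((real ^ 'n) \<times> (real ^ 'n)) \<times> real \<Rightarrow> real" where
  "on_edges \<epsilon> u = (\<lambda>(e, t). u (edge_point \<epsilon> e t))"

definition grid_deriv :: "real \<Rightarrow> (real ^ 'n \<Rightarrow> real) \<Rightarrow> ((real ^ 'n) \<times> (real ^ 'n)) \<times> real \<Rightarrow> real" where
  "grid_deriv \<epsilon> u = (\<lambda>(e, t). weak_deriv \<epsilon> (\<lambda>s. u (edge_point \<epsilon> e s)) t)"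

text \<open>Only the values on \<^term>\<open>metric_grid \<epsilon>\<close> of a function \<open>u\<close> matter. The subspace topology coincides
  with the topology of the metric graph.\<close>

definition H1_grid :: "real \<Rightarrow> (real ^ 'n \<Rightarrow> real) set" where
  "H1_grid \<epsilon> = {u. continuous_on (metric_grid \<epsilon>) u
     \<and> (\<forall>e\<in>grid_edges \<epsilon>. (\<lambda>t. u (edge_point \<epsilon> e t)) \<in> H1_interval \<epsilon>)
     \<and> sq_integrable (grid_measure \<epsilon>) (grid_deriv \<epsilon> u)
     \<and> sq_integrable (grid_measure \<epsilon>) (on_edges \<epsilon> u)}"

definition critical_exponent :: "nat \<Rightarrow> real" where
  "critical_exponent d = 2 * real d / (real d - 2)"

end

theory Submission
  imports Defs
begin

text \<open>On a single edge, testing the weak derivative against smooth approximations of the indicator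
  of \<open>[a, b]\<close> and applying Cauchy--Schwarz gives \<open>\<bar>u(b) - u(a)\<bar> \<le> (b - a)\<^sup>1\<^sup>/\<^sup>2 \<parallel>u'\<parallel>\<close>. Hence the discrete
  Dirichlet energy of \<open>u\<close> restricted to the vertices is at most \<open>\<epsilon> \<parallel>u'\<parallel>\<^sup>2\<close>, and the supremum bound follows
  from the sum bound, since every point of the grid is within \<open>\<epsilon>/2\<close> of a vertex.

  The sum bound is thus the Sobolev inequality on \<open>\<int>\<^sup>d\<close>. A function supported on a set \<open>A\<close> satisfies the
  Faber--Krahn inequality \<open>\<Sum>f\<^sup>2 \<le> K \<bar>A\<bar>\<^sup>2\<^sup>/\<^sup>d E(f)\<close>: translating by the points of a cube with at least
  \<open>2\<bar>A\<bar>\<close> elements moves each point of \<open>A\<close> outside \<open>A\<close> at least half of the time. Applied to the slices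
  of \<open>f\<close> between dyadic levels \<open>\<lambda>\<^sub>j\<close> (Maz'ya truncation), whose energies add up to at most \<open>E(f)\<close>, this
  becomes a recursive inequality for \<open>\<lambda>\<^sub>j\<^sup>p \<bar>{f > \<lambda>\<^sub>j}\<bar>\<close>, and summing it over \<open>j\<close> gives the Sobolev inequality.\<close>

section \<open>Faber--Krahn inequality on the integer lattice\<close>

text \<open>Values in \<open>ennreal\<close> keep the energy defined before any summability is
  known. Every lattice edge is counted once, by its lower end and its direction.\<close>

definition lattice_energy :: "(int ^ 'n \<Rightarrow> real) \<Rightarrow> ennreal" where
  "lattice_energy f =
     (\<integral>\<^sup>+(x, i). ennreal ((f (x + axis i 1) - f x)\<^sup>2) \<partial>count_space UNIV)"

section \<open>Translations and the Dirichlet energy\<close>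

lemma nn_integral_lattice_shift:
  fixes h :: "int ^ 'n \<Rightarrow> ennreal"
  shows "(\<integral>\<^sup>+x. h (x + z) \<partial>count_space UNIV) = (\<integral>\<^sup>+x. h x \<partial>count_space UNIV)"
proof (rule nn_integral_bij_count_space)
  show "bij_betw (\<lambda>x. x + z) (UNIV :: (int ^ 'n) set) UNIV"
    by (rule bij_betwI[where g = "\<lambda>x. x - z"]) auto
qed

lemma nn_integral_count_space_inj_le:
  fixes h :: "'b \<Rightarrow> ennreal"
  assumes "inj_on \<tau> A" "\<tau> ` A \<subseteq> B"
  shows "(\<integral>\<^sup>+x. h (\<tau> x) \<partial>count_space A) \<le> (\<integral>\<^sup>+y. h y \<partial>count_space B)"
proof -
  have "(\<integral>\<^sup>+x. h (\<tau> x) \<partial>count_space A) = (\<integral>\<^sup>+y. h y \<partial>count_space (\<tau> ` A))"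
    using assms(1) by (intro nn_integral_bij_count_space) (simp add: bij_betw_def)
  also have "\<dots> \<le> (\<integral>\<^sup>+y. h y \<partial>count_space B)"
    by (simp add: nn_integral_count_space_indicator)
      (use assms(2) in \<open>force intro!: nn_integral_mono split: split_indicator\<close>)
  finally show ?thesis .
qed

lemma sum_inj_le_nn_integral_count_space:
  fixes h :: "'b \<Rightarrow> ennreal"
  assumes "finite X" "inj_on \<tau> X" "\<tau> ` X \<subseteq> B"
  shows "(\<Sum>x\<in>X. h (\<tau> x)) \<le> (\<integral>\<^sup>+y. h y \<partial>count_space B)"
  using nn_integral_count_space_inj_le[OF assms(2,3), of h] assms(1)
  by (simp add: nn_integral_count_space_finite)

lemma lattice_energy_unit_shift:
  "(\<integral>\<^sup>+x. ennreal ((f (x + axis i 1) - f x)\<^sup>2) \<partial>count_space UNIV) \<le> lattice_energy f"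
  using nn_integral_count_space_inj_le[of "\<lambda>x. (x, i)" UNIV UNIV
      "\<lambda>(x, i). ennreal ((f (x + axis i 1) - f x)\<^sup>2)"]
  by (simp add: lattice_energy_def inj_on_def)

text \<open>A monotone path of \<open>m\<close> unit steps joins \<open>x\<close> to
  \<open>x + z\<close>, and each step costs at most \<open>sqrt D\<close> in the l2 norm;
  Minkowski's inequality would give \<open>m * sqrt D\<close>. The induction reproduces this with
  squares only.\<close>

lemma lattice_shift_bound:
  fixes f :: "int ^ 'n \<Rightarrow> real"
  assumes "lattice_energy f \<le> ennreal D" "0 \<le> D"
    and "\<And>i. 0 \<le> z $ i" "(\<Sum>i\<in>UNIV. z $ i) = int m"
  shows "(\<integral>\<^sup>+x. ennreal ((f (x + z) - f x)\<^sup>2) \<partial>count_space UNIV) \<le> ennreal ((real m)\<^sup>2 * D)"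
  using assms(3,4)
proof (induction m arbitrary: z)
  case 0
  then have "z = 0"
    by (simp add: vec_eq_iff sum_nonneg_eq_0_iff)
  then show ?case by simp
next
  case (Suc m)
  obtain i where i: "z $ i > 0"
  proof -
    have "\<exists>i. z $ i \<noteq> 0"
      using Suc.prems(2) by (metis of_nat_0 of_nat_eq_iff sum.neutral nat.distinct(1))
    then show thesis using that Suc.prems(1) by (metis order_less_le)
  qed
  define w where "w = z - axis i 1"
  have z: "z = w + axis i 1" by (simp add: w_def)
  have w0: "0 \<le> w $ j" for j
    using Suc.prems(1)[of j] i by (auto simp: w_def axis_def)
  have wsum: "(\<Sum>j\<in>UNIV. w $ j) = int m"
    using Suc.prems(2) by (simp add: w_def sum_subtractf axis_def)
  note IH = Suc.IH[OF w0 wsum]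
  show ?case
  \<comment> \<open>The weight \<open>1 / m\<close> used below requires a positive \<open>m\<close>,
    so a single step is treated separately.\<close>
  proof (cases "m = 0")
    case True
    then have "w = 0"
      using wsum w0 by (simp add: vec_eq_iff sum_nonneg_eq_0_iff)
    then have "z = axis i 1" by (simp add: z)
    then show ?thesis
      using lattice_energy_unit_shift[of f i] assms(1) True by simp
  next
    case False
    \<comment> \<open>Young's inequality with the weight for which the constants add up exactly:
      \<open>(1 + 1/m) * m^2 + (1 + m) = (m + 1)^2\<close>.\<close>
    have pt: "(f (x + z) - f x)\<^sup>2 \<le> (1 + 1 / real m) * (f (x + w) - f x)\<^sup>2
        + (1 + real m) * (f (x + w + axis i 1) - f (x + w))\<^sup>2" for x
    proof -
      define s t where "s = f (x + w) - f x" and "t = f (x + w + axis i 1) - f (x + w)"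
      have "0 \<le> (s - real m * t)\<^sup>2 / real m" by simp
      also have "\<dots> = (1 + 1 / real m) * s\<^sup>2 + (1 + real m) * t\<^sup>2 - (s + t)\<^sup>2"
        using False by (simp add: field_simps power2_eq_square)
      finally have "(s + t)\<^sup>2 \<le> (1 + 1 / real m) * s\<^sup>2 + (1 + real m) * t\<^sup>2" by simp
      then show ?thesis by (simp add: s_def t_def z add.assoc)
    qed
    have "(\<integral>\<^sup>+x. ennreal ((f (x + z) - f x)\<^sup>2) \<partial>count_space UNIV)
        \<le> (\<integral>\<^sup>+x. ennreal (1 + 1 / real m) * ennreal ((f (x + w) - f x)\<^sup>2)
            + ennreal (1 + real m) * ennreal ((f (x + w + axis i 1) - f (x + w))\<^sup>2)
            \<partial>count_space UNIV)"
      using pt by (intro nn_integral_mono)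
        (simp add: ennreal_mult[symmetric] ennreal_plus[symmetric] del: ennreal_plus)
    also have "\<dots> = ennreal (1 + 1 / real m)
          * (\<integral>\<^sup>+x. ennreal ((f (x + w) - f x)\<^sup>2) \<partial>count_space UNIV)
        + ennreal (1 + real m)
          * (\<integral>\<^sup>+x. ennreal ((f (x + w + axis i 1) - f (x + w))\<^sup>2) \<partial>count_space UNIV)"
      by (simp add: nn_integral_add nn_integral_cmult)
    also have "(\<integral>\<^sup>+x. ennreal ((f (x + w + axis i 1) - f (x + w))\<^sup>2) \<partial>count_space UNIV)
        = (\<integral>\<^sup>+x. ennreal ((f (x + axis i 1) - f x)\<^sup>2) \<partial>count_space UNIV)"
      by (rule nn_integral_lattice_shift)
    also have "ennreal (1 + 1 / real m)
          * (\<integral>\<^sup>+x. ennreal ((f (x + w) - f x)\<^sup>2) \<partial>count_space UNIV)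
        + ennreal (1 + real m)
          * (\<integral>\<^sup>+x. ennreal ((f (x + axis i 1) - f x)\<^sup>2) \<partial>count_space UNIV)
        \<le> ennreal (1 + 1 / real m) * ennreal ((real m)\<^sup>2 * D) + ennreal (1 + real m) * ennreal D"
      by (intro add_mono mult_left_mono IH order_trans[OF lattice_energy_unit_shift assms(1)]) auto
    also have "\<dots> = ennreal ((1 + 1 / real m) * ((real m)\<^sup>2 * D) + (1 + real m) * D)"
      using assms(2) by (simp add: ennreal_mult[symmetric] ennreal_plus[symmetric] del: ennreal_plus)
    also have "(1 + 1 / real m) * ((real m)\<^sup>2 * D) + (1 + real m) * D = (real (Suc m))\<^sup>2 * D"
      using False by (simp add: field_simps power2_eq_square)
    finally show ?thesis .
  qed
qed

section \<open>Averaging over a cube of translations\<close>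

lemma card_lattice_cube:
  "card {z :: int ^ 'n. \<forall>i. z $ i \<in> {0..<int r}} = r ^ CARD('n)"
proof -
  have "bij_betw vec_lambda (PiE (UNIV :: 'n set) (\<lambda>_. {0..<int r}))
      {z :: int ^ 'n. \<forall>i. z $ i \<in> {0..<int r}}"
    by (rule bij_betwI[where g = vec_nth]) (auto simp: PiE_def Pi_def)
  from bij_betw_same_card[OF this] show ?thesis
    by (simp add: card_PiE)
qed

text \<open>Double counting of \<open>(f (x + z) - f x)^2\<close> over \<open>x\<close> in
  \<open>A\<close> and \<open>z\<close> in the cube: the shift bound controls it from above for each
  \<open>z\<close>, and the points that leave \<open>A\<close> control it from below for each
  \<open>x\<close>.\<close>

lemma lattice_faber_krahn_cube:
  fixes f :: "int ^ 'n \<Rightarrow> real"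
  assumes E: "lattice_energy f \<le> ennreal D" "0 \<le> D"
    and A: "finite A" "\<And>x. x \<notin> A \<Longrightarrow> f x = 0"
    and r: "2 * card A \<le> r ^ CARD('n)"
  shows "(\<Sum>x\<in>A. (f x)\<^sup>2) \<le> 2 * (real CARD('n) * real r)\<^sup>2 * D"
proof (cases "r = 0")
  case True
  then have "card A = 0" using r by (simp add: zero_power)
  then show ?thesis using True A(1) by simp
next
  case False
  define Q where "Q = {z :: int ^ 'n. \<forall>i. z $ i \<in> {0..<int r}}"
  have cQ: "card Q = r ^ CARD('n)" unfolding Q_def by (rule card_lattice_cube)
  have fQ: "finite Q" using cQ False by (metis card.infinite power_not_zero)
  have shift: "(\<Sum>x\<in>A. (f (x + z) - f x)\<^sup>2) \<le> (real CARD('n) * real r)\<^sup>2 * D" if "z \<in> Q" for z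
  proof -
    define m where "m = nat (\<Sum>i\<in>UNIV. z $ i)"
    have z0: "0 \<le> z $ i" "z $ i \<le> int r" for i using that by (auto simp: Q_def less_imp_le)
    have m: "(\<Sum>i\<in>UNIV. z $ i) = int m"
      using z0 by (simp add: m_def sum_nonneg)
    have "(\<Sum>i\<in>UNIV. z $ i) \<le> (\<Sum>i\<in>(UNIV::'n set). int r)"
      by (intro sum_mono z0)
    \<comment> \<open>The number of unit steps is the l1 length of \<open>z\<close>, hence at most
      the dimension times the side of the cube.\<close>
    then have mle: "real m \<le> real CARD('n) * real r"
      unfolding m by (simp flip: of_nat_mult)
    have "ennreal (\<Sum>x\<in>A. (f (x + z) - f x)\<^sup>2) = (\<Sum>x\<in>A. ennreal ((f (x + z) - f x)\<^sup>2))"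
      by (simp add: sum_ennreal)
    also have "\<dots> \<le> ennreal ((real m)\<^sup>2 * D)"
      using sum_inj_le_nn_integral_count_space[OF A(1) inj_on_id2 subset_UNIV] lattice_shift_bound[OF E z0(1) m]
      by (rule order_trans)
    finally have "(\<Sum>x\<in>A. (f (x + z) - f x)\<^sup>2) \<le> (real m)\<^sup>2 * D"
      using E(2) by (simp add: ennreal_le_iff)
    also have "\<dots> \<le> (real CARD('n) * real r)\<^sup>2 * D"
      using mle E(2) by (intro mult_right_mono power_mono) auto
    finally show ?thesis .
  qed
  \<comment> \<open>By injectivity of translation at most \<open>card A\<close>, so at most half, of
    the points \<open>z\<close> keep \<open>x + z\<close> in \<open>A\<close>. For the others
    \<open>f (x + z) = 0\<close> and the difference is \<open>- f x\<close>.\<close>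
  have half: "real (card Q) / 2 * (f x)\<^sup>2 \<le> (\<Sum>z\<in>Q. (f (x + z) - f x)\<^sup>2)" if "x \<in> A" for x
  proof -
    have "card {z \<in> Q. x + z \<in> A} \<le> card A"
      by (rule card_inj_on_le[where f = "\<lambda>z. x + z"]) (auto simp: A inj_on_def)
    moreover have "card Q = card {z \<in> Q. x + z \<in> A} + card {z \<in> Q. x + z \<notin> A}"
      using fQ by (subst card_Un_disjoint[symmetric]) (auto intro: arg_cong[where f = card])
    ultimately have "real (card Q) / 2 \<le> real (card {z \<in> Q. x + z \<notin> A})"
      using r cQ by linarith
    then have "real (card Q) / 2 * (f x)\<^sup>2 \<le> (\<Sum>z | z \<in> Q \<and> x + z \<notin> A. (f x)\<^sup>2)"
      by (simp only: sum_constant of_nat_mult, intro mult_right_mono) auto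
    also have "\<dots> = (\<Sum>z | z \<in> Q \<and> x + z \<notin> A. (f (x + z) - f x)\<^sup>2)"
      by (rule sum.cong) (auto simp: A)
    also have "\<dots> \<le> (\<Sum>z\<in>Q. (f (x + z) - f x)\<^sup>2)"
      using fQ by (intro sum_mono2) auto
    finally show ?thesis .
  qed
  have "real (card Q) / 2 * (\<Sum>x\<in>A. (f x)\<^sup>2) \<le> (\<Sum>x\<in>A. \<Sum>z\<in>Q. (f (x + z) - f x)\<^sup>2)"
    unfolding sum_distrib_left by (intro sum_mono half)
  also have "\<dots> = (\<Sum>z\<in>Q. \<Sum>x\<in>A. (f (x + z) - f x)\<^sup>2)" by (rule sum.swap)
  also have "\<dots> \<le> (\<Sum>z\<in>Q. (real CARD('n) * real r)\<^sup>2 * D)" by (intro sum_mono shift)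
  finally have "real (card Q) * (\<Sum>x\<in>A. (f x)\<^sup>2)
      \<le> real (card Q) * (2 * (real CARD('n) * real r)\<^sup>2 * D)" by simp
  then show ?thesis using cQ False by simp
qed

text \<open>The side of the cube is \<open>(2 * card A)\<close> to the power \<open>1/d\<close>,
  rounded up. Rounding at most doubles it, since it is at least 1. The constant is
  \<open>32 = 2 * 2^2 * 4\<close>, the last factor bounding \<open>2 powr (2/d)\<close>.\<close>

lemma lattice_faber_krahn:
  fixes f :: "int ^ 'n \<Rightarrow> real"
  assumes E: "lattice_energy f \<le> ennreal D" "0 \<le> D"
    and A: "finite A" "\<And>x. x \<notin> A \<Longrightarrow> f x = 0"
  shows "(\<Sum>x\<in>A. (f x)\<^sup>2) \<le> 32 * (real CARD('n))\<^sup>2 * real (card A) powr (2 / CARD('n)) * D"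
proof (cases "card A = 0")
  case True
  then show ?thesis using A by simp
next
  case False
  let ?d = "real CARD('n)"
  have d1: "?d \<ge> 1" using zero_less_card_finite[where 'a='n] by linarith
  define y where "y = (2 * real (card A)) powr (1 / ?d)"
  define r where "r = nat \<lceil>y\<rceil>"
  have y1: "y \<ge> 1" unfolding y_def using False by (intro ge_one_powr_ge_zero) auto
  have ry: "y \<le> real r" unfolding r_def by linarith
  have ry2: "real r \<le> 2 * y" unfolding r_def using y1 by linarith
  have "y ^ CARD('n) = 2 * real (card A)"
    unfolding y_def using False d1 by (subst powr_realpow[symmetric]) (simp_all add: powr_powr)
  then have "2 * real (card A) \<le> real r ^ CARD('n)"
    using power_mono[OF ry, of "CARD('n)"] y1 by simp
  then have "2 * card A \<le> r ^ CARD('n)"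
    by (simp flip: of_nat_power add: of_nat_le_iff[where 'a=real, symmetric] del: of_nat_le_iff)
  from lattice_faber_krahn_cube[OF E A this]
  have "(\<Sum>x\<in>A. (f x)\<^sup>2) \<le> 2 * (?d * real r)\<^sup>2 * D" .
  also have "\<dots> \<le> 2 * (?d * (2 * y))\<^sup>2 * D"
    using E(2) ry2 by (intro mult_right_mono mult_left_mono power_mono) auto
  also have "y\<^sup>2 = 2 powr (2 / ?d) * real (card A) powr (2 / ?d)"
    unfolding y_def using False by (simp add: powr_mult power_mult_distrib powr_power)
  then have "2 * (?d * (2 * y))\<^sup>2 * D
      = 8 * ?d\<^sup>2 * D * (2 powr (2 / ?d) * real (card A) powr (2 / ?d))"
    by (simp add: power_mult_distrib)
  also have "\<dots> \<le> 8 * ?d\<^sup>2 * D * (4 * real (card A) powr (2 / ?d))"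
  proof (intro mult_left_mono mult_right_mono)
    have "2 powr (2 / ?d) \<le> 2 powr (2::real)"
      using d1 by (intro powr_mono) (auto simp: field_simps)
    then show "2 powr (2 / ?d) \<le> 4" by simp
  qed (use E in auto)
  finally show ?thesis by (simp add: ac_simps)
qed

section \<open>Sobolev inequality on the integer lattice\<close>

text \<open>Meant for \<open>b j\<close> a level to the power \<open>p\<close> times the size of its
  superlevel set and \<open>e j\<close> a multiple of the energy of a slice. The crude bound
  \<open>B\<close> guarantees a finite supremum and does not survive in the conclusion.\<close>

lemma sum_superlinear_recursion_le:
  fixes b e :: "nat \<Rightarrow> real"
  assumes b0: "\<And>j. 0 \<le> b j" and bdd: "\<And>j. b j \<le> B"
    and e0: "\<And>j. 0 \<le> e j" and e: "\<And>n. (\<Sum>j<n. e j) \<le> S"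
    and rec: "\<And>j. b j \<le> e j * b (Suc j) powr \<theta>"
    and \<theta>: "0 \<le> \<theta>" "\<theta> < 1"
  shows "(\<Sum>j<n. b j) \<le> S powr (1 / (1 - \<theta>))"
proof -
  \<comment> \<open>The supremum \<open>M\<close> satisfies \<open>M \<le> S M\<^sup>\<theta>\<close>, which bounds it because it is finite.\<close>
  define M where "M = (SUP j. b j)"
  have bM: "b j \<le> M" for j
    unfolding M_def by (rule cSUP_upper) (auto intro!: bdd_aboveI bdd)
  have M0: "0 \<le> M" using b0[of 0] bM[of 0] by linarith
  have S0: "0 \<le> S" using e[of 0] by simp
  have eS: "e j \<le> S" for j
    using e[of "Suc j"] sum_nonneg[of "{..<j}" e] e0 by simp
  have recM: "b j \<le> e j * M powr \<theta>" for j
    using rec[of j] mult_left_mono[OF powr_mono2[OF \<theta>(1) b0 bM] e0] by (rule order_trans)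
  have "M \<le> S * M powr \<theta>"
    unfolding M_def
  proof (rule cSUP_least)
    show "b j \<le> S * (SUP j. b j) powr \<theta>" for j
      using recM[of j] eS[of j] unfolding M_def by (meson mult_right_mono order_trans powr_ge_zero)
  qed simp
  have M_le: "M \<le> S powr (1 / (1 - \<theta>))"
  proof (cases "M = 0")
    case False
    then have "M > 0" using M0 by simp
    have "M powr (1 - \<theta>) \<le> S"
      using \<open>M \<le> S * M powr \<theta>\<close> \<open>M > 0\<close> by (simp add: powr_diff field_simps)
    then have "(M powr (1 - \<theta>)) powr (1 / (1 - \<theta>)) \<le> S powr (1 / (1 - \<theta>))"
      using \<theta> by (intro powr_mono2) auto
    then show ?thesis using \<open>M > 0\<close> \<theta> by (simp add: powr_powr)
  qed simp
  \<comment> \<open>Second use of the recursion: the factor \<open>b (Suc j)\<close> is frozen at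
    the supremum, now bounded in terms of \<open>S\<close>, and only the \<open>e j\<close> are
    summed.\<close>
  have "(\<Sum>j<n. b j) \<le> (\<Sum>j<n. e j) * M powr \<theta>"
    unfolding sum_distrib_right by (intro sum_mono recM)
  also have "\<dots> \<le> S * (S powr (1 / (1 - \<theta>))) powr \<theta>"
    using M0 M_le S0 e \<theta> by (intro mult_mono powr_mono2) auto
  also have "\<dots> = S powr (1 / (1 - \<theta>))"
  proof (cases "S = 0")
    case False
    then have "S * (S powr (1 / (1 - \<theta>))) powr \<theta> = S powr (1 + \<theta> / (1 - \<theta>))"
      using S0 by (simp add: powr_powr powr_add)
    also have "1 + \<theta> / (1 - \<theta>) = 1 / (1 - \<theta>)" using \<theta> by (simp add: field_simps)
    finally show ?thesis .
  qed simp
  finally show ?thesis .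
qed

text \<open>Maz'ya truncation to the band between \<open>\<Lambda> / 2 ^ Suc j\<close> and
  \<open>\<Lambda> / 2 ^ j\<close>, lowered to start at 0. For nonnegative \<open>\<Lambda>\<close>
  it vanishes below the band and has the constant value \<open>\<Lambda> / 2 ^ Suc j\<close> above
  it. The bands descend as \<open>j\<close> grows.\<close>

definition dyadic_slice :: "real \<Rightarrow> nat \<Rightarrow> real \<Rightarrow> real" where
  "dyadic_slice \<Lambda> j s = min s (\<Lambda> / 2 ^ j) - min s (\<Lambda> / 2 ^ Suc j)"

text \<open>Each slice is monotone, so its increments between \<open>s\<close> and \<open>t\<close>
  share one sign, and they telescope to at most the full increment. Nonnegative numbers with sum at
  most \<open>T\<close> have squares with sum at most \<open>T^2\<close>.\<close>

lemma sum_dyadic_slice_diff_sq_le: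
  assumes "0 \<le> \<Lambda>"
  shows "(\<Sum>j<n. (dyadic_slice \<Lambda> j s - dyadic_slice \<Lambda> j t)\<^sup>2) \<le> (s - t)\<^sup>2"
  using assms
proof (induction s t rule: linorder_wlog)
  case (le s t)
  define c where "c j = dyadic_slice \<Lambda> j t - dyadic_slice \<Lambda> j s" for j
  have "\<Lambda> / 2 ^ Suc j \<le> \<Lambda> / 2 ^ j" for j using le(2) by (simp add: field_simps)
  then have c0: "0 \<le> c j" for j
    using le(1) by (simp add: c_def dyadic_slice_def min_def del: power_Suc) (smt (verit))
  \<comment> \<open>Telescoping leaves the part of the increment that lies between
    \<open>\<Lambda> / 2 ^ n\<close> and \<open>\<Lambda>\<close>.\<close>
  have "(\<Sum>j<n. c j) = (min t \<Lambda> - min s \<Lambda>) - (min t (\<Lambda> / 2 ^ n) - min s (\<Lambda> / 2 ^ n))"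
    by (induction n) (simp_all add: c_def dyadic_slice_def)
  also have "\<dots> \<le> t - s" using le(1) by (simp add: min_def)
  finally have sum_le: "(\<Sum>j<n. c j) \<le> t - s" .
  have "c j \<le> t - s" if "j < n" for j
    using sum_le member_le_sum[of j "{..<n}" c] c0 that by force
  then have "(\<Sum>j<n. (c j)\<^sup>2) \<le> (\<Sum>j<n. (t - s) * c j)"
    using c0 by (intro sum_mono) (auto simp: power2_eq_square intro: mult_right_mono)
  also have "\<dots> \<le> (t - s) * (t - s)"
    unfolding sum_distrib_left[symmetric] using sum_le le(1) by (intro mult_left_mono) auto
  finally show ?case by (simp add: c_def power2_commute power2_eq_square algebra_simps)
next
  case (sym s t)
  then show ?case by (simp add: power2_commute)
qed

lemma sum_lattice_energy_dyadic_slice_le: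
  fixes f :: "int ^ 'n \<Rightarrow> real"
  assumes "0 \<le> \<Lambda>"
  shows "(\<Sum>j<n. lattice_energy (\<lambda>x. dyadic_slice \<Lambda> j (f x))) \<le> lattice_energy f"
  unfolding lattice_energy_def
  by (subst nn_integral_sum[symmetric])
    (auto intro!: nn_integral_mono ennreal_leI sum_dyadic_slice_diff_sq_le assms)

text \<open>The outer \<open>2 powr p\<close> comes from replacing values by dyadic levels. Inside
  are the Faber-Krahn constant and a second \<open>2 powr p\<close>, namely 4 from the slice height
  \<open>lv j / 2\<close> times \<open>2 powr (p - 2)\<close> from comparing consecutive levels. The
  exponent \<open>p / 2\<close> is \<open>1 / (1 - \<theta>)\<close> with
  \<open>\<theta> = 2 / d\<close>.\<close>

definition lattice_sobolev_const :: "nat \<Rightarrow> real" where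
  "lattice_sobolev_const d = (let p = critical_exponent d in
     2 powr p * (32 * (real d)\<^sup>2 * 2 powr p) powr (p / 2))"

text \<open>Square summability enters qualitatively: it bounds \<open>f\<close>, makes superlevel
  sets finite and gives the crude bound needed for the recursion. The estimate itself is free of
  \<open>B\<close>.\<close>

lemma lattice_sobolev_nonneg:
  fixes f :: "int ^ 'n \<Rightarrow> real"
  assumes d: "CARD('n) \<ge> 3"
    and f0: "\<And>x. 0 \<le> f x"
    and l2: "\<And>X. finite X \<Longrightarrow> (\<Sum>x\<in>X. (f x)\<^sup>2) \<le> B"
    and E: "lattice_energy f \<le> ennreal D" "0 \<le> D"
    and X: "finite X"
  defines "p \<equiv> critical_exponent CARD('n)"
  shows "(\<Sum>x\<in>X. f x powr p) \<le> lattice_sobolev_const CARD('n) * D powr (p / 2)"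
proof -
  define \<theta> where "\<theta> = 2 / real CARD('n)"
  have \<theta>: "0 \<le> \<theta>" "\<theta> < 1" using d by (auto simp: \<theta>_def)
  have p2: "p > 2" using d by (simp add: p_def critical_exponent_def field_simps)
  \<comment> \<open>These identities single out the critical exponent: the first makes the powers of
    the levels match in the recursion, the second produces the final power of
    \<open>D\<close>.\<close>
  have p\<theta>: "p * \<theta> = p - 2" "1 / (1 - \<theta>) = p / 2"
    using d by (auto simp: p_def \<theta>_def critical_exponent_def field_simps)
  define K where "K = 32 * (real CARD('n))\<^sup>2"
  have K0: "K \<ge> 0" by (simp add: K_def)
  have B0: "0 \<le> B" using l2[of "{}"] by simp
  \<comment> \<open>An upper bound for \<open>f\<close>; adding 1 keeps it positive when
    \<open>B = 0\<close>.\<close>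
  define \<Lambda> where "\<Lambda> = sqrt B + 1"
  have \<Lambda>0: "\<Lambda> > 0" using B0 by (simp add: \<Lambda>_def add_nonneg_pos)
  define lv where "lv j = \<Lambda> / 2 ^ j" for j :: nat
  have lv0: "lv j > 0" for j using \<Lambda>0 by (simp add: lv_def)
  have lvS: "lv j = 2 * lv (Suc j)" for j by (simp add: lv_def)
  have lv_le: "lv j \<le> \<Lambda>" for j using \<Lambda>0 by (simp add: lv_def divide_le_eq mult_left_mono)
  have f_le: "f x \<le> \<Lambda>" for x
    using l2[of "{x}"] real_le_rsqrt by (force simp: \<Lambda>_def)
  define A where "A j = {x. f x > lv j}" for j
  \<comment> \<open>Chebyshev's inequality, for finite subsets first because finiteness of
    \<open>A j\<close> is deduced from it.\<close>
  have cardA: "(lv j)\<^sup>2 * real (card Y) \<le> B" if "finite Y" "Y \<subseteq> A j" for Y j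
  proof -
    have "(\<Sum>x\<in>Y. (lv j)\<^sup>2) \<le> (\<Sum>x\<in>Y. (f x)\<^sup>2)"
      using that lv0[of j] by (intro sum_mono power_mono) (auto simp: A_def less_imp_le)
    also have "\<dots> \<le> B" by (rule l2[OF that(1)])
    finally show ?thesis by (simp add: mult.commute)
  qed
  have finA: "finite (A j)" for j
  proof (rule ccontr)
    assume "infinite (A j)"
    then obtain Y where Y: "Y \<subseteq> A j" "finite Y" "card Y = nat \<lceil>B / (lv j)\<^sup>2\<rceil> + 1"
      using infinite_arbitrarily_large by blast
    then have "real (card Y) > B / (lv j)\<^sup>2" by linarith
    then show False using cardA[OF Y(2,1)] lv0[of j] by (simp add: field_simps)
  qed
  define a where "a j = real (card (A j))" for j
  define b where "b j = lv j powr p * a j" for j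
  have a0: "0 \<le> a j" for j by (simp add: a_def)
  have b0: "0 \<le> b j" for j by (simp add: b_def a0)
  have bB: "b j \<le> \<Lambda> powr (p - 2) * B" for j
  proof -
    have "b j = lv j powr (p - 2) * ((lv j)\<^sup>2 * a j)"
      using lv0[of j] by (simp add: b_def powr_diff flip: powr_numeral)
    also have "\<dots> \<le> \<Lambda> powr (p - 2) * B"
      using lv0[of j] p2 lv_le[of j] cardA[OF finA order_refl, of j] a0[of j]
      by (intro mult_mono powr_mono2) (auto simp: a_def)
    finally show ?thesis .
  qed
  define G where "G j = (\<lambda>x. dyadic_slice \<Lambda> j (f x))" for j
  have G_sum: "(\<Sum>j<n. lattice_energy (G j)) \<le> ennreal D" for n
    unfolding G_def using sum_lattice_energy_dyadic_slice_le[of \<Lambda> f n] \<Lambda>0 E(1) by force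
  have G_fin: "lattice_energy (G j) < top" for j
    using G_sum[of "Suc j"] by (auto simp: less_top[symmetric] top_unique)
  define D' where "D' j = enn2real (lattice_energy (G j))" for j
  have D'0: "0 \<le> D' j" for j by (simp add: D'_def)
  have D'_eq: "lattice_energy (G j) = ennreal (D' j)" for j
    using G_fin[of j] by (simp add: D'_def)
  have D'_sum: "(\<Sum>j<n. D' j) \<le> D" for n
    using G_sum[of n] E(2) D'0 by (simp add: D'_eq sum_ennreal)
  \<comment> \<open>The slice equals \<open>lv j / 2\<close> on \<open>A j\<close> and vanishes off
    \<open>A (Suc j)\<close>, so Faber-Krahn on the larger set bounds the size of the smaller one.
    Multiplying by \<open>lv j powr (p - 2)\<close> and using \<open>p * \<theta> = p - 2\<close>
    turns the right side into a power of \<open>b (Suc j)\<close>.\<close>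
  have rec: "b j \<le> (K * 2 powr p * D' j) * b (Suc j) powr \<theta>" for j
  proof -
    have slice0: "G j x = 0" if "x \<notin> A (Suc j)" for x
      using that lvS[of j] lv0[of "Suc j"] unfolding G_def dyadic_slice_def lv_def[symmetric] A_def
      by (auto simp: min_def)
    have slice1: "G j x = lv j / 2" if "x \<in> A j" for x
      using that lvS[of j] lv0[of "Suc j"] unfolding G_def dyadic_slice_def lv_def[symmetric] A_def
      by (auto simp: min_def)
    have sub: "A j \<subseteq> A (Suc j)" using lvS[of j] lv0[of "Suc j"] by (auto simp: A_def)
    have "(lv j)\<^sup>2 / 4 * a j = (\<Sum>x\<in>A j. (G j x)\<^sup>2)"
      by (simp add: slice1 a_def power_divide)
    also have "\<dots> \<le> (\<Sum>x\<in>A (Suc j). (G j x)\<^sup>2)"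
      using sub finA by (intro sum_mono2) auto
    also have "\<dots> \<le> K * a (Suc j) powr \<theta> * D' j"
      unfolding K_def a_def \<theta>_def
      using D'_eq D'0 finA slice0 by (intro lattice_faber_krahn) auto
    finally have FK: "(lv j)\<^sup>2 * a j \<le> 4 * (K * a (Suc j) powr \<theta> * D' j)" by simp
    have "b j = lv j powr (p - 2) * ((lv j)\<^sup>2 * a j)"
      using lv0[of j] by (simp add: b_def powr_diff flip: powr_numeral)
    also have "\<dots> \<le> lv j powr (p - 2) * (4 * (K * a (Suc j) powr \<theta> * D' j))"
      by (intro mult_left_mono FK) simp
    also have "lv j powr (p - 2) = 2 powr (p - 2) * lv (Suc j) powr (p * \<theta>)"
      using lv0[of "Suc j"] by (subst lvS) (simp add: powr_mult p\<theta>)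
    also have "(2::real) powr (p - 2) = 2 powr p / 4" by (simp add: powr_diff)
    also have "2 powr p / 4 * lv (Suc j) powr (p * \<theta>) * (4 * (K * a (Suc j) powr \<theta> * D' j))
        = (K * 2 powr p * D' j) * (lv (Suc j) powr p * a (Suc j)) powr \<theta>"
      using a0[of "Suc j"] by (simp add: powr_mult powr_powr)
    finally show ?thesis by (simp add: b_def)
  qed
  have b_sum: "(\<Sum>j<n. b j) \<le> (K * 2 powr p * D) powr (p / 2)" for n
    unfolding p\<theta>(2)[symmetric]
  proof (rule sum_superlinear_recursion_le[where e = "\<lambda>j. K * 2 powr p * D' j", OF b0 bB _ _ rec \<theta>])
    show "0 \<le> K * 2 powr p * D' j" for j using K0 D'0 by simp
    show "(\<Sum>j<n. K * 2 powr p * D' j) \<le> K * 2 powr p * D" for n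
      unfolding sum_distrib_left[symmetric] using K0 by (intro mult_left_mono D'_sum) simp
  qed
  \<comment> \<open>For positive \<open>f x\<close> take the first level below it. It is not the top
    level, as \<open>f x \<le> \<Lambda>\<close>, so the preceding level is at least
    \<open>f x\<close> and exactly twice as large.\<close>
  have "\<exists>j. f x powr p \<le> 2 powr p * (if x \<in> A j then lv j powr p else 0)" for x
  proof (cases "f x = 0")
    case False
    then have "f x > 0" using f0[of x] by simp
    obtain m where "\<Lambda> / f x < 2 ^ m" using real_arch_pow[of 2] by auto
    then have "lv m < f x" using \<open>f x > 0\<close> by (simp add: lv_def field_simps)
    define m0 where "m0 = (LEAST m. lv m < f x)"
    have m0: "lv m0 < f x" unfolding m0_def using \<open>lv m < f x\<close> by (rule LeastI)
    have "m0 \<noteq> 0"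
    proof
      assume "m0 = 0"
      then show False using m0 f_le[of x] by (simp add: lv_def)
    qed
    then obtain k where k: "m0 = Suc k" using not0_implies_Suc by blast
    have "\<not> lv k < f x" using k not_less_Least[of k "\<lambda>m. lv m < f x"] by (simp add: m0_def)
    then have "f x \<le> 2 * lv m0" using lvS[of k] k by simp
    then have "f x powr p \<le> (2 * lv m0) powr p"
      using f0[of x] p2 by (intro powr_mono2) auto
    then show ?thesis using m0 lv0[of m0] by (intro exI[of _ m0]) (auto simp: A_def powr_mult)
  qed auto
  then obtain J where J:
    "\<And>x. f x powr p \<le> 2 powr p * (if x \<in> A (J x) then lv (J x) powr p else 0)" by metis
  \<comment> \<open>Finiteness of \<open>X\<close> bounds the selected levels, so one finite sum
    over \<open>j\<close> serves all points. Swapping the sums then counts the points of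
    \<open>X\<close> in each superlevel set.\<close>
  obtain n where n: "\<And>x. x \<in> X \<Longrightarrow> J x < n"
    using finite_nat_set_iff_bounded[of "J ` X"] X by auto
  have "(\<Sum>x\<in>X. f x powr p) \<le> (\<Sum>x\<in>X. \<Sum>j<n. 2 powr p * (if x \<in> A j then lv j powr p else 0))"
  proof (rule sum_mono)
    fix x assume "x \<in> X"
    note J[of x]
    also have "2 powr p * (if x \<in> A (J x) then lv (J x) powr p else 0)
        \<le> (\<Sum>j<n. 2 powr p * (if x \<in> A j then lv j powr p else 0))"
      using n[OF \<open>x \<in> X\<close>] by (intro member_le_sum) auto
    finally show "f x powr p \<le> (\<Sum>j<n. 2 powr p * (if x \<in> A j then lv j powr p else 0))" .
  qed
  also have "\<dots> = 2 powr p * (\<Sum>j<n. \<Sum>x\<in>X. if x \<in> A j then lv j powr p else 0)"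
    by (subst sum.swap) (simp add: sum_distrib_left)
  also have "\<dots> \<le> 2 powr p * (\<Sum>j<n. b j)"
  proof (intro mult_left_mono sum_mono)
    fix j
    have "(\<Sum>x\<in>X. if x \<in> A j then lv j powr p else 0) = real (card (X \<inter> A j)) * lv j powr p"
      using X by (simp add: sum.If_cases Collect_mem_eq)
    also have "\<dots> \<le> b j"
      unfolding b_def a_def using finA[of j]
      by (subst mult.commute) (intro mult_left_mono, auto intro!: card_mono)
    finally show "(\<Sum>x\<in>X. if x \<in> A j then lv j powr p else 0) \<le> b j" .
  qed simp
  also have "\<dots> \<le> 2 powr p * (K * 2 powr p * D) powr (p / 2)"
    by (intro mult_left_mono b_sum) simp
  also have "\<dots> = lattice_sobolev_const CARD('n) * D powr (p / 2)"
    using K0 E(2) by (simp add: lattice_sobolev_const_def Let_def p_def K_def powr_mult)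
  finally show ?thesis .
qed

lemma lattice_energy_abs_le: "lattice_energy (\<lambda>x. \<bar>f x\<bar>) \<le> lattice_energy f"
  unfolding lattice_energy_def
  by (intro nn_integral_mono) (auto intro!: ennreal_leI simp: abs_le_square_iff[symmetric])

lemma lattice_sobolev:
  fixes f :: "int ^ 'n \<Rightarrow> real"
  assumes "CARD('n) \<ge> 3"
    and "\<And>X. finite X \<Longrightarrow> (\<Sum>x\<in>X. (f x)\<^sup>2) \<le> B"
    and "lattice_energy f \<le> ennreal D" "0 \<le> D" "finite X"
  defines "p \<equiv> critical_exponent CARD('n)"
  shows "(\<Sum>x\<in>X. \<bar>f x\<bar> powr p) \<le> lattice_sobolev_const CARD('n) * D powr (p / 2)"
  unfolding p_def
  by (rule lattice_sobolev_nonneg[where B = B])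
    (use assms lattice_energy_abs_le[of f] in \<open>auto intro: order_trans\<close>)

section \<open>Smooth cut-offs and weak derivatives on an interval\<close>

text \<open>On the positive half-line this is \<open>exp (-1/x) / x^n\<close>. The extra index makes
  the family closed under differentiation up to linear combinations, which yields smoothness at 0
  without formulas for higher derivatives.\<close>

definition exp_flat :: "nat \<Rightarrow> real \<Rightarrow> real" where
  "exp_flat n x = (if 0 < x then inverse x ^ n / exp (inverse x) else 0)"

lemma exp_flat_nonneg: "0 \<le> exp_flat n x"
  by (simp add: exp_flat_def)

lemma exp_flat_tendsto_0: "(exp_flat n \<longlongrightarrow> 0) (at 0)"
proof (rule filterlim_split_at)
  have "eventually (\<lambda>x. exp_flat n x = 0) (at_left 0)"
    by (auto simp: eventually_at_filter exp_flat_def)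
  then show "(exp_flat n \<longlongrightarrow> 0) (at_left 0)"
    by (rule tendsto_eventually)
  have "((\<lambda>x. inverse x ^ n / exp (inverse x)) \<longlongrightarrow> (0::real)) (at_right 0)"
    by (rule filterlim_compose[OF tendsto_power_div_exp_0 filterlim_inverse_at_top_right])
  then show "(exp_flat n \<longlongrightarrow> 0) (at_right 0)"
    by (rule Lim_transform_eventually) (auto simp: eventually_at_filter exp_flat_def)
qed

lemma exp_flat_deriv:
  "(exp_flat n has_real_derivative exp_flat (n + 2) x - real n * exp_flat (n + 1) x) (at x)"
proof -
  consider "x < 0" | "x = 0" | "x > 0" by linarith
  then show ?thesis
  proof cases
    case 1
    have "((\<lambda>_. 0) has_real_derivative 0) (at x)" by simp
    then have "(exp_flat n has_real_derivative 0) (at x)"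
      by (rule has_field_derivative_transform_within_open[where S = "{..<0}"])
        (use 1 in \<open>auto simp: exp_flat_def\<close>)
    then show ?thesis using 1 by (simp add: exp_flat_def)
  next
    case 2
    \<comment> \<open>The difference quotient of \<open>exp_flat n\<close> at 0 is
      \<open>exp_flat (Suc n)\<close> itself.\<close>
    have "(exp_flat (Suc n) \<longlongrightarrow> 0) (at 0)" by (rule exp_flat_tendsto_0)
    then have "((\<lambda>y. (exp_flat n y - exp_flat n 0) / (y - 0)) \<longlongrightarrow> 0) (at 0)"
      by (rule Lim_transform_eventually)
        (auto simp: eventually_at_filter exp_flat_def field_simps)
    then show ?thesis using 2 by (simp add: has_field_derivative_iff exp_flat_def)
  next
    case 3
    have "((\<lambda>x. inverse x ^ n / exp (inverse x)) has_real_derivative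
        exp_flat (n + 2) x - real n * exp_flat (n + 1) x) (at x)"
      using 3
      by (auto intro!: derivative_eq_intros simp: exp_flat_def field_simps power2_eq_square)
        (cases n; simp add: field_simps)
    then show ?thesis
      by (rule has_field_derivative_transform_within_open[where S = "{0<..}"])
        (use 3 in \<open>auto simp: exp_flat_def\<close>)
  qed
qed

text \<open>The span of products that are flat at both ends of \<open>[0, 1]\<close>. Being closed
  under \<open>deriv\<close>, it consists of smooth functions.\<close>

inductive_set bump_span :: "(real \<Rightarrow> real) set" where
  base: "(\<lambda>x. exp_flat m x * exp_flat n (1 - x)) \<in> bump_span"
| add: "f \<in> bump_span \<Longrightarrow> g \<in> bump_span \<Longrightarrow> (\<lambda>x. f x + g x) \<in> bump_span"
| scale: "f \<in> bump_span \<Longrightarrow> (\<lambda>x. c * f x) \<in> bump_span"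

lemma bump_span_deriv:
  assumes "f \<in> bump_span"
  shows "\<exists>g\<in>bump_span. \<forall>x. (f has_real_derivative g x) (at x)"
  using assms
proof induction
  case (base m n)
  define g where "g x = (exp_flat (m + 2) x * exp_flat n (1 - x)
      + (- real m) * (exp_flat (m + 1) x * exp_flat n (1 - x)))
    + ((- 1) * (exp_flat m x * exp_flat (n + 2) (1 - x))
      + real n * (exp_flat m x * exp_flat (n + 1) (1 - x)))" for x
  have "g \<in> bump_span"
    unfolding g_def by (intro bump_span.intros)
  moreover have "((\<lambda>x. exp_flat m x * exp_flat n (1 - x)) has_real_derivative g x) (at x)" for x
  proof -
    have "((\<lambda>x. exp_flat n (1 - x)) has_real_derivative
        (exp_flat (n + 2) (1 - x) - real n * exp_flat (n + 1) (1 - x)) * (0 - 1)) (at x)"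
      by (rule DERIV_chain2[OF exp_flat_deriv]) (intro derivative_intros)
    from DERIV_mult[OF exp_flat_deriv[of m x] this] show ?thesis
      by (simp add: g_def algebra_simps)
  qed
  ultimately show ?case by blast
next
  case (add f g)
  then obtain f' g' where "f' \<in> bump_span" "g' \<in> bump_span"
    "\<And>x. (f has_real_derivative f' x) (at x)" "\<And>x. (g has_real_derivative g' x) (at x)" by blast
  then show ?case
    by (intro bexI[of _ "\<lambda>x. f' x + g' x"] allI DERIV_add bump_span.add)
next
  case (scale f c)
  then obtain f' where "f' \<in> bump_span" "\<And>x. (f has_real_derivative f' x) (at x)" by blast
  then show ?case
    by (intro bexI[of _ "\<lambda>x. c * f' x"] allI DERIV_cmult bump_span.scale)
qed

lemma funpow_deriv_bump_span: "f \<in> bump_span \<Longrightarrow> (deriv ^^ n) f \<in> bump_span"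
proof (induction n)
  case (Suc n)
  then obtain g where "g \<in> bump_span" "\<And>x. ((deriv ^^ n) f has_real_derivative g x) (at x)"
    using bump_span_deriv by blast
  moreover from this have "deriv ((deriv ^^ n) f) = g" by (auto intro: DERIV_imp_deriv)
  ultimately show ?case by simp
qed simp

lemma bump_span_smooth: "f \<in> bump_span \<Longrightarrow> (deriv ^^ n) f differentiable (at x)"
  using bump_span_deriv[OF funpow_deriv_bump_span] real_differentiable_def by blast

text \<open>A primitive of a bump on \<open>[0, 1]\<close>, normalised to rise from 0 to 1. The
  derivative \<open>S'\<close> is returned as well since its rescalings serve as approximate delta
  kernels.\<close>

lemma smooth_step_exists:
  obtains S S' :: "real \<Rightarrow> real" where
    "\<And>n x. (deriv ^^ n) S differentiable (at x)"
    "\<And>x. (S has_real_derivative S' x) (at x)" "continuous_on UNIV S'" "\<And>x. 0 \<le> S' x"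
    "\<And>x. x \<notin> {0..1} \<Longrightarrow> S' x = 0"
    "\<And>x. x \<le> 0 \<Longrightarrow> S x = 0" "\<And>x. 1 \<le> x \<Longrightarrow> S x = 1" "\<And>x. 0 \<le> S x" "\<And>x. S x \<le> 1"
proof -
  define h where "h x = exp_flat 0 x * exp_flat 0 (1 - x)" for x
  have h_span: "h \<in> bump_span" unfolding h_def by (rule bump_span.base)
  have h0: "0 \<le> h x" for x by (simp add: h_def exp_flat_nonneg)
  have h_out: "h x = 0" if "x \<notin> {0<..<1}" for x using that by (auto simp: h_def exp_flat_def)
  have h_in: "0 < h x" if "x \<in> {0<..<1}" for x using that by (auto simp: h_def exp_flat_def)
  have h_cont: "isCont h x" for x
    using bump_span_deriv[OF h_span] DERIV_isCont by blast
  obtain F where F: "\<And>x. (F has_real_derivative h x) (at x)"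
    using einterval_antiderivative[of "-\<infinity>" "\<infinity>" h] h_cont
    by (auto simp: has_real_derivative_iff_has_vector_derivative)
  have F_cont: "continuous_on T F" for T
    using F by (meson DERIV_isCont continuous_at_imp_continuous_on)
  have F01: "F 0 < F 1"
    by (rule DERIV_pos_imp_increasing_open[OF _ _ F_cont]) (use F h_in in force)+
  have F_mono: "F x \<le> F y" if "x \<le> y" for x y
    by (rule DERIV_nonneg_imp_nondecreasing[OF that]) (use F h0 in blast)
  have F_left: "F x = F 0" if "x \<le> 0" for x
  proof (cases "x = 0")
    case False
    have "(F has_real_derivative 0) (at t)" if "t < 0" for t
      using F[of t] h_out[of t] that by simp
    then show ?thesis using DERIV_isconst_end[of x 0 F] that False F_cont by force
  qed simp
  have F_right: "F x = F 1" if "1 \<le> x" for x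
  proof (cases "x = 1")
    case False
    have "(F has_real_derivative 0) (at t)" if "1 < t" for t
      using F[of t] h_out[of t] that by simp
    then show ?thesis using DERIV_isconst_end[of 1 x F] that False F_cont by force
  qed simp
  define c where "c = inverse (F 1 - F 0)"
  have c0: "c > 0" using F01 by (simp add: c_def)
  define S where "S x = c * (F x - F 0)" for x
  define S' where "S' x = c * h x" for x
  have S'_span: "S' \<in> bump_span" unfolding S'_def by (rule bump_span.scale[OF h_span])
  have S: "(S has_real_derivative S' x) (at x)" for x
    unfolding S_def S'_def by (auto intro!: derivative_eq_intros F)
  then have "deriv S = S'" by (auto intro: DERIV_imp_deriv)
  show thesis
  proof
    show "(deriv ^^ n) S differentiable (at x)" for n x
    proof (cases n)
      case 0
      then show ?thesis using S real_differentiable_def by auto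
    next
      case (Suc m)
      then have "(deriv ^^ n) S = (deriv ^^ m) S'"
        using \<open>deriv S = S'\<close> by (simp add: funpow_swap1)
      then show ?thesis using bump_span_smooth[OF S'_span] by simp
    qed
    show "continuous_on UNIV S'"
      unfolding S'_def using h_cont
      by (intro continuous_intros) (simp add: continuous_on_eq_continuous_at)
    show "0 \<le> S' x" for x using c0 h0 by (simp add: S'_def)
    show "S' x = 0" if "x \<notin> {0..1}" for x using that h_out[of x] by (auto simp: S'_def)
    show "S x = 0" if "x \<le> 0" for x using F_left[OF that] by (simp add: S_def)
    show "S x = 1" if "1 \<le> x" for x using F_right[OF that] F01 by (simp add: S_def c_def)
    show "0 \<le> S x" for x
      using F_mono[of "min x 0" x] F_left[of "min x 0"] c0 by (simp add: S_def)
    show "S x \<le> 1" for x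
      using F_mono[of x "max x 1"] F_right[of "max x 1"] F01 by (simp add: S_def c_def field_simps)
  qed (rule S)
qed

section \<open>Smooth approximations of the indicator of an interval\<close>

lemma funpow_deriv_affine_diff:
  fixes S :: "real \<Rightarrow> real"
  assumes smooth: "\<And>n x. (deriv ^^ n) S differentiable (at x)"
  shows "(deriv ^^ n) (\<lambda>x. S ((x - a) / \<delta>) - S ((x - b) / \<delta>))
    = (\<lambda>x. ((deriv ^^ n) S ((x - a) / \<delta>) - (deriv ^^ n) S ((x - b) / \<delta>)) / \<delta> ^ n)"
proof (induction n)
  case (Suc n)
  have *: "((\<lambda>x. (deriv ^^ n) S ((x - c) / \<delta>)) has_real_derivative
      (deriv ^^ Suc n) S ((x - c) / \<delta>) * (1 / \<delta>)) (at x)" for c x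
  proof (rule DERIV_chain2[where f = "(deriv ^^ n) S"])
    show "((deriv ^^ n) S has_real_derivative (deriv ^^ Suc n) S ((x - c) / \<delta>))
        (at ((x - c) / \<delta>))"
      using smooth by (simp add: DERIV_deriv_iff_real_differentiable)
  \<comment> \<open>For \<open>\<delta> = 0\<close> division by zero gives 0, so the inner function
    is constant and \<open>1 / \<delta>\<close> is still its derivative.\<close>
  qed (cases "\<delta> = 0"; auto intro!: derivative_eq_intros)
  have "deriv (\<lambda>x. ((deriv ^^ n) S ((x - a) / \<delta>) - (deriv ^^ n) S ((x - b) / \<delta>)) / \<delta> ^ n)
      = (\<lambda>x. ((deriv ^^ Suc n) S ((x - a) / \<delta>) * (1 / \<delta>)
          - (deriv ^^ Suc n) S ((x - b) / \<delta>) * (1 / \<delta>)) / \<delta> ^ n)"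
    by (rule ext, rule DERIV_imp_deriv) (intro DERIV_cdivide DERIV_diff *)
  then have "(deriv ^^ Suc n) (\<lambda>x. S ((x - a) / \<delta>) - S ((x - b) / \<delta>))
      = (\<lambda>x. ((deriv ^^ Suc n) S ((x - a) / \<delta>) * (1 / \<delta>)
          - (deriv ^^ Suc n) S ((x - b) / \<delta>) * (1 / \<delta>)) / \<delta> ^ n)"
    by (simp only: funpow.simps o_apply Suc.IH)
  then show ?case
    by (simp add: diff_divide_distrib)
qed simp

text \<open>Both steps are 0 left of \<open>a\<close> and both are 1 right of
  \<open>b + \<delta>\<close>, so their difference is supported in \<open>[a, b + \<delta>]\<close>,
  a compact part of the open interval.\<close>

lemma smooth_plateau_test_function:
  fixes S :: "real \<Rightarrow> real"
  assumes smooth: "\<And>n x. (deriv ^^ n) S differentiable (at x)"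
    and S: "\<And>x. x \<le> 0 \<Longrightarrow> S x = 0" "\<And>x. 1 \<le> x \<Longrightarrow> S x = 1"
    and ab: "0 < a" "a < b" "0 < \<delta>" "b + \<delta> < l"
  shows "(\<lambda>x. S ((x - a) / \<delta>) - S ((x - b) / \<delta>)) \<in> test_functions l"
proof -
  let ?\<phi> = "\<lambda>x. S ((x - a) / \<delta>) - S ((x - b) / \<delta>)"
  have "(deriv ^^ n) ?\<phi> differentiable (at x)" for n x
  proof -
    have "(\<lambda>x. (deriv ^^ n) S ((x - c) / \<delta>)) differentiable (at x)" for c
      by (rule differentiable_compose[where f = "(deriv ^^ n) S"])
        (use smooth ab(3) in \<open>auto intro!: derivative_intros\<close>)
    then show ?thesis
      unfolding funpow_deriv_affine_diff[OF smooth] using ab(3) by (intro derivative_intros) auto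
  qed
  moreover have sub: "closure {x. ?\<phi> x \<noteq> 0} \<subseteq> {a..b + \<delta>}"
  proof (rule closure_minimal)
    show "{x. ?\<phi> x \<noteq> 0} \<subseteq> {a..b + \<delta>}"
    proof (rule subsetI, rule ccontr)
      fix x assume x: "x \<in> {x. ?\<phi> x \<noteq> 0}" "x \<notin> {a..b + \<delta>}"
      then consider "x < a" | "x > b + \<delta>" by fastforce
      then show False
      proof cases
        case 1
        then have "S ((x - a) / \<delta>) = 0" "S ((x - b) / \<delta>) = 0"
          using ab by (auto intro!: S(1) simp: divide_le_0_iff)
        then show ?thesis using x by simp
      next
        case 2
        then have "S ((x - a) / \<delta>) = 1" "S ((x - b) / \<delta>) = 1"
          using ab by (auto intro!: S(2) simp: le_divide_eq)
        then show ?thesis using x by simp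
      qed
    qed
  qed simp
  moreover have "compact (closure {x. ?\<phi> x \<noteq> 0})"
    using bounded_subset[OF bounded_closed_interval order_trans[OF closure_subset sub]]
    by (simp only: compact_closure)
  moreover have "{a..b + \<delta>} \<subseteq> {0<..<l}" using ab by auto
  ultimately show ?thesis unfolding test_functions_def by blast
qed

section \<open>Point values from weak derivatives\<close>

lemma Cauchy_Schwarz_L2norm:
  assumes "sq_integrable M f" "sq_integrable M g"
  shows "\<bar>\<integral>x. f x * g x \<partial>M\<bar> \<le> L2norm M f * L2norm M g"
proof -
  define A B I where "A = (\<integral>x. (f x)\<^sup>2 \<partial>M)" and "B = (\<integral>x. (g x)\<^sup>2 \<partial>M)" and "I = (\<integral>x. f x * g x \<partial>M)"
  have [measurable]: "f \<in> borel_measurable M" "g \<in> borel_measurable M"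
    and int2: "integrable M (\<lambda>x. (f x)\<^sup>2)" "integrable M (\<lambda>x. (g x)\<^sup>2)"
    using assms by (auto simp: sq_integrable_def)
  have int: "integrable M (\<lambda>x. f x * g x)"
  proof (rule Bochner_Integration.integrable_bound)
    show "integrable M (\<lambda>x. (f x)\<^sup>2 + (g x)\<^sup>2)" using int2 by simp
    have "\<bar>f x * g x\<bar> \<le> (f x)\<^sup>2 + (g x)\<^sup>2" for x
    proof -
      have "2 * \<bar>f x * g x\<bar> \<le> (f x)\<^sup>2 + (g x)\<^sup>2"
        using sum_squares_bound[of "\<bar>f x\<bar>" "\<bar>g x\<bar>"] by (simp add: abs_mult mult.assoc)
      then show ?thesis using abs_ge_zero[of "f x * g x"] by linarith
    qed
    then show "AE x in M. norm (f x * g x) \<le> norm ((f x)\<^sup>2 + (g x)\<^sup>2)" by simp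
  qed simp
  have quad: "0 \<le> s\<^sup>2 * A - 2 * s * t * I + t\<^sup>2 * B" for s t
  proof -
    have "0 \<le> (\<integral>x. (s * f x - t * g x)\<^sup>2 \<partial>M)" by simp
    also have "(\<lambda>x. (s * f x - t * g x)\<^sup>2)
        = (\<lambda>x. s\<^sup>2 * (f x)\<^sup>2 - 2 * s * t * (f x * g x) + t\<^sup>2 * (g x)\<^sup>2)"
      by (auto simp: power2_eq_square algebra_simps)
    also have "(\<integral>x. s\<^sup>2 * (f x)\<^sup>2 - 2 * s * t * (f x * g x) + t\<^sup>2 * (g x)\<^sup>2 \<partial>M)
        = s\<^sup>2 * A - 2 * s * t * I + t\<^sup>2 * B"
      unfolding A_def B_def I_def using int int2 by simp
    finally show ?thesis .
  qed
  have AB: "0 \<le> A" "0 \<le> B" by (simp_all add: A_def B_def)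
  have "I\<^sup>2 \<le> A * B"
  proof (cases "B = 0")
    case True
    have "I = 0"
    proof (rule ccontr)
      assume "I \<noteq> 0"
      \<comment> \<open>This choice makes the quadratic form equal to -1.\<close>
      then show False using quad[of 1 "(A + 1) / (2 * I)"] True AB by simp
    qed
    then show ?thesis using AB by simp
  next
    case False
    have "0 \<le> B * (A * B - I\<^sup>2)"
      using quad[of B I] by (simp add: power2_eq_square algebra_simps)
    then show ?thesis using False AB by (simp add: zero_le_mult_iff)
  qed
  then have "\<bar>I\<bar> \<le> sqrt (A * B)" by (simp add: real_le_rsqrt)
  then show ?thesis by (simp add: L2norm_def A_def B_def I_def real_sqrt_mult)
qed

text \<open>Integration against a probability density is an average, and the average sees only
  points where \<open>f\<close> is within \<open>\<eta>\<close> of \<open>c\<close>.\<close>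

lemma integral_concentrated_kernel_bound:
  fixes f \<rho> :: "real \<Rightarrow> real"
  assumes f: "continuous_on {0..l} f" and \<rho>: "continuous_on {0..l} \<rho>"
    and \<rho>0: "\<And>t. 0 \<le> \<rho> t" and \<rho>1: "(\<rho> has_integral 1) {0..l}"
    and near: "\<And>t. t \<in> {0..l} \<Longrightarrow> \<rho> t \<noteq> 0 \<Longrightarrow> \<bar>f t - c\<bar> \<le> \<eta>"
  shows "\<bar>(\<integral>t. f t * \<rho> t \<partial>lebesgue_on {0..l}) - c\<bar> \<le> \<eta>"
proof -
  have int: "(\<lambda>t. f t * \<rho> t) integrable_on {0..l}"
    by (intro integrable_continuous_interval continuous_intros f \<rho>)
  have "(\<integral>t. f t * \<rho> t \<partial>lebesgue_on {0..l}) = integral {0..l} (\<lambda>t. f t * \<rho> t)"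
    by (intro lebesgue_integral_eq_integral continuous_imp_integrable_real continuous_intros f \<rho>) simp
  moreover have "((\<lambda>t. c * \<rho> t) has_integral c) {0..l}"
    using has_integral_mult_right[OF \<rho>1, of c] by simp
  ultimately have "(\<integral>t. f t * \<rho> t \<partial>lebesgue_on {0..l}) - c
      = integral {0..l} (\<lambda>t. f t * \<rho> t - c * \<rho> t)"
    using integral_unique[OF has_integral_diff[OF integrable_integral[OF int]]] by simp
  moreover have "norm (integral {0..l} (\<lambda>t. f t * \<rho> t - c * \<rho> t)) \<le> integral {0..l} (\<lambda>t. \<eta> * \<rho> t)"
  proof (rule integral_norm_bound_integral)
    show "(\<lambda>t. f t * \<rho> t - c * \<rho> t) integrable_on {0..l}"
      by (intro integrable_continuous_interval continuous_intros f \<rho>)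
    show "(\<lambda>t. \<eta> * \<rho> t) integrable_on {0..l}"
      by (intro integrable_continuous_interval continuous_intros \<rho>)
    show "norm (f t * \<rho> t - c * \<rho> t) \<le> \<eta> * \<rho> t" if "t \<in> {0..l}" for t
      using near[OF that] \<rho>0[of t]
      by (cases "\<rho> t = 0") (auto simp: abs_mult mult_right_mono simp flip: left_diff_distrib)
  qed
  moreover have "integral {0..l} (\<lambda>t. \<eta> * \<rho> t) = \<eta>"
    using integral_unique[OF has_integral_mult_right[OF \<rho>1, of \<eta>]] by (simp only: mult_1_right)
  ultimately show ?thesis by (simp only: real_norm_def)
qed

text \<open>Tested against the plateau, \<open>f\<close> contributes its average just right of
  \<open>a\<close> minus its average just right of \<open>b\<close>, each within
  \<open>\<eta>\<close> of the point value. The other side is bounded by Cauchy-Schwarz, the plateau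
  having squared norm at most \<open>b - a + \<eta>\<close>.\<close>

lemma weak_deriv_diff_bound_approx:
  fixes f g :: "real \<Rightarrow> real"
  assumes f: "continuous_on {0..l} f" and g: "has_weak_deriv l f g"
    and ab: "0 < a" "a < b" "b < l" and \<eta>: "0 < \<eta>"
  shows "\<bar>f b - f a\<bar> \<le> 2 * \<eta> + sqrt (b - a + \<eta>) * L2norm (lebesgue_on {0..l}) g"
proof -
  obtain S S' :: "real \<Rightarrow> real" where S:
    "\<And>n x. (deriv ^^ n) S differentiable (at x)"
    "\<And>x. (S has_real_derivative S' x) (at x)" "continuous_on UNIV S'" "\<And>x. 0 \<le> S' x"
    "\<And>x. x \<notin> {0..1} \<Longrightarrow> S' x = 0"
    "\<And>x. x \<le> 0 \<Longrightarrow> S x = 0" "\<And>x. 1 \<le> x \<Longrightarrow> S x = 1" "\<And>x. 0 \<le> S x" "\<And>x. S x \<le> 1"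
    using smooth_step_exists by blast
  have "\<exists>d>0. \<forall>t\<in>{0..l}. dist t c < d \<longrightarrow> dist (f t) (f c) < \<eta>" if "c \<in> {0..l}" for c
    using f that \<eta> unfolding continuous_on_iff by blast
  from this[of a] this[of b] obtain d1 d2 where d:
    "d1 > 0" "\<And>t. t \<in> {0..l} \<Longrightarrow> dist t a < d1 \<Longrightarrow> dist (f t) (f a) < \<eta>"
    "d2 > 0" "\<And>t. t \<in> {0..l} \<Longrightarrow> dist t b < d2 \<Longrightarrow> dist (f t) (f b) < \<eta>"
    using ab by auto
  \<comment> \<open>Small enough for the continuity of \<open>f\<close> at \<open>a\<close> and
    \<open>b\<close>, for the support to stay left of \<open>l\<close>, and for the norm of the
    plateau; the halves give strict inequalities.\<close>
  define \<delta> where "\<delta> = Min {d1 / 2, d2 / 2, (l - b) / 2, \<eta>}"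
  have \<delta>: "\<delta> > 0" "\<delta> < d1" "\<delta> < d2" "b + \<delta> < l" "\<delta> \<le> \<eta>"
  proof -
    have "\<delta> \<le> d1 / 2" "\<delta> \<le> d2 / 2" "\<delta> \<le> (l - b) / 2" "\<delta> \<le> \<eta>"
      unfolding \<delta>_def by (rule Min_le; simp)+
    then show "\<delta> < d1" "\<delta> < d2" "b + \<delta> < l" "\<delta> \<le> \<eta>"
      using d(1,3) ab by (auto simp: field_simps)
    show "\<delta> > 0" using d ab \<eta> by (simp add: \<delta>_def)
  qed
  \<comment> \<open>The derivative of the step rescaled to \<open>[c, c + \<delta>]\<close>, a
    kernel of mass 1 there.\<close>
  define \<rho> where "\<rho> c t = S' ((t - c) / \<delta>) / \<delta>" for c t
  have \<rho>_cont: "continuous_on {0..l} (\<rho> c)" for c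
    unfolding \<rho>_def using \<delta>(1)
    by (intro continuous_intros continuous_on_compose2[OF S(3)]) auto
  have \<rho>_nonneg: "0 \<le> \<rho> c t" for c t using S(4) \<delta>(1) by (simp add: \<rho>_def)
  have \<rho>_supp: "t \<in> {c..c + \<delta>}" if "\<rho> c t \<noteq> 0" for c t
  proof -
    have "(t - c) / \<delta> \<in> {0..1}" using that S(5) by (auto simp: \<rho>_def)
    then show ?thesis using \<delta>(1) by (simp add: field_simps)
  qed
  have step_deriv: "((\<lambda>t. S ((t - c) / \<delta>)) has_real_derivative \<rho> c t) (at t)" for c t
    using DERIV_chain2[OF S(2), of "\<lambda>t. (t - c) / \<delta>" "1 / \<delta>" t] \<delta>(1)
    by (force simp: \<rho>_def intro!: derivative_eq_intros)
  have \<rho>_int: "(\<rho> c has_integral 1) {0..l}" if "0 < c" "c + \<delta> < l" for c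
  proof -
    have "(\<rho> c has_integral S ((l - c) / \<delta>) - S ((0 - c) / \<delta>)) {0..l}"
      using that \<delta>(1) step_deriv
      by (intro fundamental_theorem_of_calculus)
        (auto simp: has_real_derivative_iff_has_vector_derivative[symmetric]
          intro: has_field_derivative_at_within)
    moreover have "S ((l - c) / \<delta>) = 1" using that \<delta>(1) by (intro S(7)) (simp add: field_simps)
    moreover have "S ((0 - c) / \<delta>) = 0" using that \<delta>(1) by (intro S(6)) simp
    ultimately show ?thesis by simp
  qed
  define \<phi> where "\<phi> x = S ((x - a) / \<delta>) - S ((x - b) / \<delta>)" for x
  have \<phi>_test: "\<phi> \<in> test_functions l"
    unfolding \<phi>_def using S \<delta> ab by (intro smooth_plateau_test_function) auto
  have \<phi>_deriv: "deriv \<phi> t = \<rho> a t - \<rho> b t" for t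
    unfolding \<phi>_def by (intro DERIV_imp_deriv DERIV_diff step_deriv)
  have \<phi>_cont: "continuous_on {0..l} \<phi>"
  proof -
    have "continuous_on {0..l} (\<lambda>t. S ((t - c) / \<delta>))" for c
      using step_deriv by (meson DERIV_isCont continuous_at_imp_continuous_on)
    then show ?thesis unfolding \<phi>_def by (intro continuous_intros)
  qed
  have \<phi>_sq: "(\<phi> t)\<^sup>2 \<le> indicator {a..b + \<delta>} t" for t
  proof (cases "t \<in> {a..b + \<delta>}")
    case True
    have "\<bar>\<phi> t\<bar> \<le> 1"
      using S(8)[of "(t - a) / \<delta>"] S(9)[of "(t - a) / \<delta>"] S(8)[of "(t - b) / \<delta>"]
        S(9)[of "(t - b) / \<delta>"] by (simp add: \<phi>_def)
    then show ?thesis using True by (simp add: abs_square_le_1)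
  next
    case False
    then consider "t < a" | "t > b + \<delta>" by fastforce
    then have "\<phi> t = 0"
      by cases (use ab \<delta>(1) in \<open>auto simp: \<phi>_def S(6,7) divide_le_0_iff le_divide_eq\<close>)
    then show ?thesis by simp
  qed
  have f\<rho>: "integrable (lebesgue_on {0..l}) (\<lambda>t. f t * \<rho> c t)" for c
    by (intro continuous_imp_integrable_real continuous_intros f \<rho>_cont)
  have \<phi>_L2: "sq_integrable (lebesgue_on {0..l}) \<phi>"
    unfolding sq_integrable_def
    using \<phi>_cont continuous_imp_integrable_real[OF \<phi>_cont]
    by (auto intro!: continuous_imp_integrable_real continuous_intros)
  have "(\<integral>t. (\<phi> t)\<^sup>2 \<partial>lebesgue_on {0..l}) \<le> (\<integral>t. indicator {a..b + \<delta>} t \<partial>lebesgue_on {0..l})"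
  proof (rule integral_mono)
    show "integrable (lebesgue_on {0..l}) (\<lambda>t. (\<phi> t)\<^sup>2)" using \<phi>_L2 by (simp add: sq_integrable_def)
    show "integrable (lebesgue_on {0..l}) (indicat_real {a..b + \<delta>})"
      using ab \<delta> by (auto simp: sets_restrict_space_iff emeasure_restrict_space)
  qed (use \<phi>_sq in auto)
  also have "\<dots> = b - a + \<delta>"
    using ab \<delta> by (auto simp: measure_restrict_space)
  finally have \<phi>_norm: "L2norm (lebesgue_on {0..l}) \<phi> \<le> sqrt (b - a + \<eta>)"
    using \<delta>(5) by (simp add: L2norm_def)
  have "(\<integral>t. f t * deriv \<phi> t \<partial>lebesgue_on {0..l})
      = (\<integral>t. f t * \<rho> a t \<partial>lebesgue_on {0..l}) - (\<integral>t. f t * \<rho> b t \<partial>lebesgue_on {0..l})"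
    using f\<rho> by (simp add: \<phi>_deriv right_diff_distrib)
  moreover have "(\<integral>t. f t * deriv \<phi> t \<partial>lebesgue_on {0..l}) = - (\<integral>t. g t * \<phi> t \<partial>lebesgue_on {0..l})"
    using g \<phi>_test by (simp add: has_weak_deriv_def)
  moreover have "\<bar>\<integral>t. g t * \<phi> t \<partial>lebesgue_on {0..l}\<bar>
      \<le> sqrt (b - a + \<eta>) * L2norm (lebesgue_on {0..l}) g"
  proof -
    have "\<bar>\<integral>t. g t * \<phi> t \<partial>lebesgue_on {0..l}\<bar>
        \<le> L2norm (lebesgue_on {0..l}) g * L2norm (lebesgue_on {0..l}) \<phi>"
      using g \<phi>_L2 by (intro Cauchy_Schwarz_L2norm) (auto simp: has_weak_deriv_def)
    also have "\<dots> \<le> L2norm (lebesgue_on {0..l}) g * sqrt (b - a + \<eta>)"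
      using \<phi>_norm by (intro mult_left_mono) (auto simp: L2norm_def)
    finally show ?thesis by (simp add: mult.commute)
  qed
  moreover have "\<bar>(\<integral>t. f t * \<rho> a t \<partial>lebesgue_on {0..l}) - f a\<bar> \<le> \<eta>"
  proof (rule integral_concentrated_kernel_bound[OF f \<rho>_cont \<rho>_nonneg \<rho>_int])
    show "\<bar>f t - f a\<bar> \<le> \<eta>" if "t \<in> {0..l}" "\<rho> a t \<noteq> 0" for t
      using d(2)[OF that(1)] \<rho>_supp[OF that(2)] \<delta> by (simp add: dist_real_def)
  qed (use ab \<delta> in auto)
  moreover have "\<bar>(\<integral>t. f t * \<rho> b t \<partial>lebesgue_on {0..l}) - f b\<bar> \<le> \<eta>"
  proof (rule integral_concentrated_kernel_bound[OF f \<rho>_cont \<rho>_nonneg \<rho>_int])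
    show "\<bar>f t - f b\<bar> \<le> \<eta>" if "t \<in> {0..l}" "\<rho> b t \<noteq> 0" for t
      using d(4)[OF that(1)] \<rho>_supp[OF that(2)] \<delta> by (simp add: dist_real_def)
  qed (use ab \<delta> in auto)
  ultimately show ?thesis by linarith
qed

text \<open>Interior points follow by letting \<open>\<eta>\<close> tend to 0. The ends of
  \<open>[0, l]\<close>, which test functions do not reach, follow by continuity of
  \<open>f\<close>.\<close>

lemma weak_deriv_diff_bound:
  fixes f g :: "real \<Rightarrow> real"
  assumes f: "continuous_on {0..l} f" and g: "has_weak_deriv l f g"
    and ab: "0 \<le> a" "a \<le> b" "b \<le> l"
  shows "\<bar>f b - f a\<bar> \<le> sqrt (b - a) * L2norm (lebesgue_on {0..l}) g"
proof (cases "a = b")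
  case False
  let ?G = "L2norm (lebesgue_on {0..l}) g"
  have interior: "\<bar>f y - f x\<bar> \<le> sqrt (y - x) * ?G" if "0 < x" "x < y" "y < l" for x y
  proof (rule tendsto_lowerbound)
    show "((\<lambda>\<eta>. 2 * \<eta> + sqrt (y - x + \<eta>) * ?G) \<longlongrightarrow> sqrt (y - x) * ?G) (at_right 0)"
      by (auto intro!: tendsto_eq_intros)
    show "\<forall>\<^sub>F \<eta> in at_right 0. \<bar>f y - f x\<bar> \<le> 2 * \<eta> + sqrt (y - x + \<eta>) * ?G"
      unfolding eventually_at_filter using weak_deriv_diff_bound_approx[OF f g that] by simp
  qed simp
  \<comment> \<open>Moving both points inwards by at most a third of their distance keeps them
    ordered and strictly inside \<open>(0, l)\<close>.\<close>
  define \<tau> where "\<tau> n = (b - a) / 3 * inverse (real (Suc n))" for n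
  have null: "\<tau> \<longlonglongrightarrow> 0"
    unfolding \<tau>_def by (rule tendsto_mult_right_zero[OF LIMSEQ_inverse_real_of_nat])
  have small: "0 < \<tau> n" "\<tau> n \<le> (b - a) / 3" for n
  proof -
    show "0 < \<tau> n" using ab False by (simp add: \<tau>_def)
    have "(b - a) / 3 * inverse (real (Suc n)) \<le> (b - a) / 3 * 1"
      using ab by (intro mult_left_mono) (auto simp: field_simps)
    then show "\<tau> n \<le> (b - a) / 3" by (simp add: \<tau>_def)
  qed
  define x y where "x n = a + \<tau> n" and "y n = b - \<tau> n" for n
  have x: "x \<longlonglongrightarrow> a" unfolding x_def using tendsto_add[OF tendsto_const null, of a] by simp
  have y: "y \<longlonglongrightarrow> b" unfolding y_def using tendsto_diff[OF tendsto_const null, of b] by simp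
  have xy: "0 < x n" "x n < y n" "y n < l" for n
    using small[of n] ab False unfolding x_def y_def by (auto simp: field_simps)
  show ?thesis
  proof (rule LIMSEQ_le)
    show "(\<lambda>n. \<bar>f (y n) - f (x n)\<bar>) \<longlonglongrightarrow> \<bar>f b - f a\<bar>"
      using xy ab
      by (intro tendsto_intros continuous_on_tendsto_compose[OF f x] continuous_on_tendsto_compose[OF f y])
        (auto intro!: always_eventually less_imp_le intro: less_trans order_trans)
    show "(\<lambda>n. sqrt (y n - x n) * ?G) \<longlonglongrightarrow> sqrt (b - a) * ?G"
      by (intro tendsto_intros x y)
    show "\<exists>N. \<forall>n\<ge>N. \<bar>f (y n) - f (x n)\<bar> \<le> sqrt (y n - x n) * ?G"
      using interior xy by blast
  qed
qed simp

section \<open>The metric grid\<close>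

lemma L2norm_nonneg: "0 \<le> L2norm M f"
  by (simp add: L2norm_def)

lemma L2norm_sq: "(L2norm M f)\<^sup>2 = (\<integral>x. (f x)\<^sup>2 \<partial>M)"
  by (simp add: L2norm_def)

lemma nn_integral_sq_eq_L2norm:
  assumes "sq_integrable M f"
  shows "(\<integral>\<^sup>+x. ennreal ((f x)\<^sup>2) \<partial>M) = ennreal ((L2norm M f)\<^sup>2)"
  using assms by (simp add: L2norm_sq sq_integrable_def nn_integral_eq_integral)

section \<open>Vertices and edges parametrised by the integer lattice\<close>

definition lattice_vertex :: "real \<Rightarrow> int ^ 'n \<Rightarrow> real ^ 'n" where
  "lattice_vertex \<epsilon> k = \<epsilon> *\<^sub>R (\<chi> i. real_of_int (k $ i))"

lemma range_lattice_vertex: "range (lattice_vertex \<epsilon>) = grid_vertices \<epsilon>"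
proof
  show "range (lattice_vertex \<epsilon>) \<subseteq> grid_vertices \<epsilon>"
    by (auto simp: lattice_vertex_def grid_vertices_def)
  show "grid_vertices \<epsilon> \<subseteq> range (lattice_vertex \<epsilon> :: int ^ 'n \<Rightarrow> real ^ 'n)"
  proof
    fix v :: "real ^ 'n" assume "v \<in> grid_vertices \<epsilon>"
    then obtain k where k: "v = \<epsilon> *\<^sub>R k" "\<And>i. k $ i \<in> \<int>" by (auto simp: grid_vertices_def)
    have "v = lattice_vertex \<epsilon> (\<chi> i. \<lfloor>k $ i\<rfloor>)"
      using k by (simp add: lattice_vertex_def vec_eq_iff)
    then show "v \<in> range (lattice_vertex \<epsilon>)" by blast
  qed
qed

lemma inj_lattice_vertex: "\<epsilon> \<noteq> 0 \<Longrightarrow> inj (lattice_vertex \<epsilon>)"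
  by (auto simp: inj_def lattice_vertex_def vec_eq_iff)

definition lattice_edge :: "real \<Rightarrow> int ^ 'n \<Rightarrow> 'n \<Rightarrow> (real ^ 'n) \<times> (real ^ 'n)" where
  "lattice_edge \<epsilon> k i = (lattice_vertex \<epsilon> k, lattice_vertex \<epsilon> (k + axis i 1))"

lemma lattice_edge_in_grid_edges:
  assumes "0 < \<epsilon>"
  shows "lattice_edge \<epsilon> k i \<in> grid_edges \<epsilon>"
proof -
  have eq: "lattice_vertex \<epsilon> (k + axis i 1) = lattice_vertex \<epsilon> k + \<epsilon> *\<^sub>R axis i 1"
    by (auto simp: lattice_vertex_def vec_eq_iff axis_def algebra_simps)
  have "dist (lattice_vertex \<epsilon> k) (lattice_vertex \<epsilon> (k + axis i 1)) = \<epsilon>"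
    unfolding eq using assms by (simp add: dist_norm norm_axis_1)
  moreover have "lattice_vertex \<epsilon> k \<le> lattice_vertex \<epsilon> (k + axis i 1)"
    unfolding eq using assms by (simp add: less_eq_vec_def axis_def)
  ultimately show ?thesis
    using range_lattice_vertex[of \<epsilon>] by (auto simp: grid_edges_def lattice_edge_def)
qed

text \<open>Lets a sum over lattice points and directions be bounded by an integral over all grid
  edges.\<close>

lemma inj_lattice_edge:
  assumes "\<epsilon> \<noteq> 0"
  shows "inj (\<lambda>(k, i). lattice_edge \<epsilon> k i)"
  by (rule injI)
    (auto simp: lattice_edge_def axis_eq_axis dest!: injD[OF inj_lattice_vertex[OF assms]])

lemma edge_point_ends:
  "edge_point \<epsilon> e 0 = fst e" "\<epsilon> \<noteq> 0 \<Longrightarrow> edge_point \<epsilon> e \<epsilon> = snd e"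
  by (simp_all add: edge_point_def)

lemma edge_point_in_metric_grid:
  assumes "0 < \<epsilon>" "e \<in> grid_edges \<epsilon>" "t \<in> {0..\<epsilon>}"
  shows "edge_point \<epsilon> e t \<in> metric_grid \<epsilon>"
proof -
  have "edge_point \<epsilon> e t = (1 - t / \<epsilon>) *\<^sub>R fst e + (t / \<epsilon>) *\<^sub>R snd e"
    by (simp add: edge_point_def algebra_simps)
  moreover have "0 \<le> t / \<epsilon>" "t / \<epsilon> \<le> 1" using assms by auto
  ultimately have "edge_point \<epsilon> e t \<in> closed_segment (fst e) (snd e)"
    unfolding closed_segment_def by blast
  then show ?thesis using assms(2) by (force simp: metric_grid_def)
qed

lemma continuous_on_edge:
  assumes "0 < \<epsilon>" "e \<in> grid_edges \<epsilon>" "u \<in> H1_grid \<epsilon>"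
  shows "continuous_on {0..\<epsilon>} (\<lambda>t. u (edge_point \<epsilon> e t))"
proof (rule continuous_on_compose2[where f = "edge_point \<epsilon> e"])
  show "continuous_on (metric_grid \<epsilon>) u" using assms by (simp add: H1_grid_def)
  show "continuous_on {0..\<epsilon>} (edge_point \<epsilon> e)"
    unfolding edge_point_def by (intro continuous_intros) (use assms in auto)
qed (use edge_point_in_metric_grid[OF assms(1,2)] in auto)

section \<open>Splitting the grid norms into contributions of single edges\<close>

definition edge_deriv_norm :: "real \<Rightarrow> (real ^ 'n \<Rightarrow> real) \<Rightarrow> (real ^ 'n) \<times> (real ^ 'n) \<Rightarrow> real" where
  "edge_deriv_norm \<epsilon> u e =
     L2norm (lebesgue_on {0..\<epsilon>}) (weak_deriv \<epsilon> (\<lambda>t. u (edge_point \<epsilon> e t)))"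

lemma has_weak_deriv_edge:
  assumes "e \<in> grid_edges \<epsilon>" "u \<in> H1_grid \<epsilon>"
  shows "has_weak_deriv \<epsilon> (\<lambda>t. u (edge_point \<epsilon> e t)) (weak_deriv \<epsilon> (\<lambda>t. u (edge_point \<epsilon> e t)))"
proof -
  obtain g where "has_weak_deriv \<epsilon> (\<lambda>t. u (edge_point \<epsilon> e t)) g"
    using assms by (auto simp: H1_grid_def H1_interval_def)
  then show ?thesis unfolding weak_deriv_def
    by (rule someI[where P = "has_weak_deriv \<epsilon> (\<lambda>t. u (edge_point \<epsilon> e t))"])
qed

lemma edge_oscillation_bound:
  assumes "0 < \<epsilon>" "e \<in> grid_edges \<epsilon>" "u \<in> H1_grid \<epsilon>" "0 \<le> s" "s \<le> t" "t \<le> \<epsilon>"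
  shows "\<bar>u (edge_point \<epsilon> e t) - u (edge_point \<epsilon> e s)\<bar> \<le> sqrt (t - s) * edge_deriv_norm \<epsilon> u e"
  unfolding edge_deriv_norm_def
  by (rule weak_deriv_diff_bound[OF continuous_on_edge[OF assms(1-3)]
        has_weak_deriv_edge[OF assms(2,3)] assms(4-6)])

text \<open>Tonelli's theorem with the edge variable outside; the inner factor is a finite measure,
  as the version used here requires sigma-finiteness of that factor.\<close>

lemma grid_nn_integral_sq:
  assumes "sq_integrable (grid_measure \<epsilon>) F"
  shows "(\<integral>\<^sup>+e. \<integral>\<^sup>+t. ennreal ((F (e, t))\<^sup>2) \<partial>lebesgue_on {0..\<epsilon>} \<partial>count_space (grid_edges \<epsilon>))
    = ennreal ((L2norm (grid_measure \<epsilon>) F)\<^sup>2)"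
proof -
  interpret finite_measure "lebesgue_on {0..\<epsilon>}"
    by (rule finite_measure_lebesgue_on) simp
  have [measurable]: "F \<in> borel_measurable (count_space (grid_edges \<epsilon>) \<Otimes>\<^sub>M lebesgue_on {0..\<epsilon>})"
    using assms by (simp add: sq_integrable_def grid_measure_def)
  show ?thesis
    unfolding nn_integral_sq_eq_L2norm[OF assms, symmetric]
    unfolding grid_measure_def
    by (rule nn_integral_fst[of "\<lambda>x. ennreal ((F x)\<^sup>2)"]) simp
qed

lemma nn_integral_edge_deriv_norm:
  assumes "u \<in> H1_grid \<epsilon>"
  shows "(\<integral>\<^sup>+e. ennreal ((edge_deriv_norm \<epsilon> u e)\<^sup>2) \<partial>count_space (grid_edges \<epsilon>))
    = ennreal ((L2norm (grid_measure \<epsilon>) (grid_deriv \<epsilon> u))\<^sup>2)"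
proof -
  have "sq_integrable (grid_measure \<epsilon>) (grid_deriv \<epsilon> u)" using assms by (simp add: H1_grid_def)
  note grid_nn_integral_sq[OF this, symmetric]
  also have "(\<integral>\<^sup>+e. \<integral>\<^sup>+t. ennreal ((grid_deriv \<epsilon> u (e, t))\<^sup>2) \<partial>lebesgue_on {0..\<epsilon>}
        \<partial>count_space (grid_edges \<epsilon>))
      = (\<integral>\<^sup>+e. ennreal ((edge_deriv_norm \<epsilon> u e)\<^sup>2) \<partial>count_space (grid_edges \<epsilon>))"
    using has_weak_deriv_edge[OF _ assms]
    by (intro nn_integral_cong)
      (simp add: grid_deriv_def edge_deriv_norm_def has_weak_deriv_def nn_integral_sq_eq_L2norm)
  finally show ?thesis by simp
qed

lemma nn_integral_edge_norm:
  assumes "u \<in> H1_grid \<epsilon>"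
  shows "(\<integral>\<^sup>+e. ennreal ((L2norm (lebesgue_on {0..\<epsilon>}) (\<lambda>t. u (edge_point \<epsilon> e t)))\<^sup>2)
      \<partial>count_space (grid_edges \<epsilon>))
    = ennreal ((L2norm (grid_measure \<epsilon>) (on_edges \<epsilon> u))\<^sup>2)"
proof -
  have "sq_integrable (grid_measure \<epsilon>) (on_edges \<epsilon> u)" using assms by (simp add: H1_grid_def)
  note grid_nn_integral_sq[OF this, symmetric]
  also have "(\<integral>\<^sup>+e. \<integral>\<^sup>+t. ennreal ((on_edges \<epsilon> u (e, t))\<^sup>2) \<partial>lebesgue_on {0..\<epsilon>}
        \<partial>count_space (grid_edges \<epsilon>))
      = (\<integral>\<^sup>+e. ennreal ((L2norm (lebesgue_on {0..\<epsilon>}) (\<lambda>t. u (edge_point \<epsilon> e t)))\<^sup>2)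
          \<partial>count_space (grid_edges \<epsilon>))"
    using assms
    by (intro nn_integral_cong)
      (simp add: on_edges_def H1_grid_def H1_interval_def nn_integral_sq_eq_L2norm)
  finally show ?thesis by simp
qed

lemma sum_edges_le_of_nn_integral:
  fixes h :: "'e \<Rightarrow> real"
  assumes "(\<integral>\<^sup>+e. ennreal (h e) \<partial>count_space B) = ennreal S" "0 \<le> S" "\<And>e. 0 \<le> h e"
    and "finite X" "inj_on \<tau> X" "\<tau> ` X \<subseteq> B"
  shows "(\<Sum>x\<in>X. h (\<tau> x)) \<le> S"
proof -
  have "ennreal (\<Sum>x\<in>X. h (\<tau> x)) = (\<Sum>x\<in>X. ennreal (h (\<tau> x)))"
    using assms(3) by (simp add: sum_ennreal)
  also have "\<dots> \<le> ennreal S"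
    using sum_inj_le_nn_integral_count_space[OF assms(4-6), of "\<lambda>e. ennreal (h e)"] assms(1) by simp
  finally show ?thesis using assms(2) by simp
qed

text \<open>The oscillation bound across a whole edge, squared, carries the factor
  \<open>\<epsilon>\<close>; summation over the edges does the rest.\<close>

lemma lattice_energy_restriction_le:
  fixes u :: "real ^ 'n \<Rightarrow> real"
  assumes \<epsilon>: "0 < \<epsilon>" and u: "u \<in> H1_grid \<epsilon>"
  shows "lattice_energy (\<lambda>k. u (lattice_vertex \<epsilon> k))
    \<le> ennreal (\<epsilon> * (L2norm (grid_measure \<epsilon>) (grid_deriv \<epsilon> u))\<^sup>2)"
proof -
  let ?\<tau> = "\<lambda>(k :: int ^ 'n, i). lattice_edge \<epsilon> k i"
  let ?h = "\<lambda>e. ennreal ((edge_deriv_norm \<epsilon> u e)\<^sup>2)"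
  have pt: "(u (lattice_vertex \<epsilon> (k + axis i 1)) - u (lattice_vertex \<epsilon> k))\<^sup>2
      \<le> \<epsilon> * (edge_deriv_norm \<epsilon> u (lattice_edge \<epsilon> k i))\<^sup>2" for k i
  proof -
    have "\<bar>u (lattice_vertex \<epsilon> (k + axis i 1)) - u (lattice_vertex \<epsilon> k)\<bar>
        \<le> sqrt \<epsilon> * edge_deriv_norm \<epsilon> u (lattice_edge \<epsilon> k i)"
      using edge_oscillation_bound[OF \<epsilon> lattice_edge_in_grid_edges[OF \<epsilon>] u, of 0 \<epsilon> k i] \<epsilon>
      by (simp add: edge_point_ends) (simp add: lattice_edge_def)
    from power_mono[OF this, of 2] show ?thesis
      using \<epsilon> by (simp add: power_mult_distrib)
  qed
  have "lattice_energy (\<lambda>k. u (lattice_vertex \<epsilon> k))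
      \<le> (\<integral>\<^sup>+x. ennreal \<epsilon> * ?h (?\<tau> x) \<partial>count_space UNIV)"
    unfolding lattice_energy_def
    using pt \<epsilon> by (intro nn_integral_mono) (auto simp: ennreal_mult[symmetric] intro!: ennreal_leI)
  also have "\<dots> = ennreal \<epsilon> * (\<integral>\<^sup>+x. ?h (?\<tau> x) \<partial>count_space UNIV)"
    by (simp add: nn_integral_cmult)
  also have "\<dots> \<le> ennreal \<epsilon> * (\<integral>\<^sup>+e. ?h e \<partial>count_space (grid_edges \<epsilon>))"
    using inj_lattice_edge[of \<epsilon>] lattice_edge_in_grid_edges[OF \<epsilon>] \<epsilon>
    by (intro mult_left_mono nn_integral_count_space_inj_le) auto
  also have "\<dots> = ennreal (\<epsilon> * (L2norm (grid_measure \<epsilon>) (grid_deriv \<epsilon> u))\<^sup>2)"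
    using \<epsilon> by (simp add: nn_integral_edge_deriv_norm[OF u] ennreal_mult[symmetric])
  finally show ?thesis .
qed

text \<open>A trace inequality: the vertex value is compared with the value at each \<open>t\<close>
  through the oscillation bound, and the squares are averaged over the edge, whence the factor
  \<open>1 / \<epsilon>\<close>.\<close>

lemma vertex_sq_le_edge_norms:
  assumes \<epsilon>: "0 < \<epsilon>" and u: "u \<in> H1_grid \<epsilon>" and e: "e \<in> grid_edges \<epsilon>"
  shows "(u (fst e))\<^sup>2 \<le> 2 / \<epsilon> * (L2norm (lebesgue_on {0..\<epsilon>}) (\<lambda>t. u (edge_point \<epsilon> e t)))\<^sup>2
    + 2 * \<epsilon> * (edge_deriv_norm \<epsilon> u e)\<^sup>2"
proof -
  let ?f = "\<lambda>t. u (edge_point \<epsilon> e t)" and ?G = "edge_deriv_norm \<epsilon> u e"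
  have int: "integrable (lebesgue_on {0..\<epsilon>}) (\<lambda>t. (?f t)\<^sup>2)"
    using u e by (simp add: H1_grid_def H1_interval_def sq_integrable_def)
  have G0: "0 \<le> ?G" by (simp add: edge_deriv_norm_def L2norm_nonneg)
  have pt: "(u (fst e))\<^sup>2 \<le> 2 * (?f t)\<^sup>2 + 2 * \<epsilon> * ?G\<^sup>2" if "t \<in> {0..\<epsilon>}" for t
  proof -
    have "\<bar>?f t - u (fst e)\<bar> \<le> sqrt (t - 0) * ?G"
      using edge_oscillation_bound[OF \<epsilon> e u, of 0 t] that by (simp add: edge_point_ends)
    also have "\<dots> \<le> sqrt \<epsilon> * ?G" using that G0 by (intro mult_right_mono) auto
    finally have "(?f t - u (fst e))\<^sup>2 \<le> \<epsilon> * ?G\<^sup>2"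
      using power_mono[of "\<bar>?f t - u (fst e)\<bar>" "sqrt \<epsilon> * ?G" 2] \<epsilon> by (simp add: power_mult_distrib)
    moreover have "(u (fst e))\<^sup>2 \<le> 2 * (?f t)\<^sup>2 + 2 * (?f t - u (fst e))\<^sup>2"
      using zero_le_power2[of "2 * ?f t - u (fst e)"] by (simp add: power2_eq_square algebra_simps)
    ultimately show ?thesis by linarith
  qed
  have "(\<integral>t. (u (fst e))\<^sup>2 \<partial>lebesgue_on {0..\<epsilon>}) \<le> (\<integral>t. 2 * (?f t)\<^sup>2 + 2 * \<epsilon> * ?G\<^sup>2 \<partial>lebesgue_on {0..\<epsilon>})"
    using pt int by (intro integral_mono) auto
  also have "(\<integral>t. 2 * (?f t)\<^sup>2 + 2 * \<epsilon> * ?G\<^sup>2 \<partial>lebesgue_on {0..\<epsilon>})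
      = 2 * (L2norm (lebesgue_on {0..\<epsilon>}) ?f)\<^sup>2 + \<epsilon> * (2 * \<epsilon> * ?G\<^sup>2)"
    using int \<epsilon> by (simp add: L2norm_sq measure_restrict_space)
  also have "(\<integral>t. (u (fst e))\<^sup>2 \<partial>lebesgue_on {0..\<epsilon>}) = \<epsilon> * (u (fst e))\<^sup>2"
    using \<epsilon> by (simp add: measure_restrict_space)
  finally show ?thesis using \<epsilon> by (simp add: field_simps power2_eq_square)
qed

text \<open>Supplies the square summability hypothesis of \<open>lattice_sobolev\<close>; the bound
  may depend on \<open>\<epsilon>\<close> and \<open>u\<close> because it disappears there.\<close>

lemma lattice_restriction_square_summable:
  fixes u :: "real ^ 'n \<Rightarrow> real"
  assumes \<epsilon>: "0 < \<epsilon>" and u: "u \<in> H1_grid \<epsilon>" and X: "finite X"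
  shows "(\<Sum>k\<in>X. (u (lattice_vertex \<epsilon> k))\<^sup>2)
    \<le> 2 / \<epsilon> * (L2norm (grid_measure \<epsilon>) (on_edges \<epsilon> u))\<^sup>2
      + 2 * \<epsilon> * (L2norm (grid_measure \<epsilon>) (grid_deriv \<epsilon> u))\<^sup>2"
proof -
  \<comment> \<open>Any fixed direction assigns to each vertex an edge starting there, different
    vertices receiving different edges.\<close>
  fix i :: 'n
  let ?\<tau> = "\<lambda>k. lattice_edge \<epsilon> k i"
  let ?U = "\<lambda>e. (L2norm (lebesgue_on {0..\<epsilon>}) (\<lambda>t. u (edge_point \<epsilon> e t)))\<^sup>2"
  let ?G = "\<lambda>e. (edge_deriv_norm \<epsilon> u e)\<^sup>2"
  have \<tau>: "inj_on ?\<tau> X" "?\<tau> ` X \<subseteq> grid_edges \<epsilon>"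
    using lattice_edge_in_grid_edges[OF \<epsilon>] inj_lattice_vertex[of \<epsilon>] \<epsilon>
    by (auto simp: inj_on_def lattice_edge_def)
  have "(\<Sum>k\<in>X. (u (lattice_vertex \<epsilon> k))\<^sup>2) \<le> (\<Sum>k\<in>X. 2 / \<epsilon> * ?U (?\<tau> k) + 2 * \<epsilon> * ?G (?\<tau> k))"
    using vertex_sq_le_edge_norms[OF \<epsilon> u lattice_edge_in_grid_edges[OF \<epsilon>], of _ i]
    by (intro sum_mono) (simp add: lattice_edge_def)
  also have "\<dots> = 2 / \<epsilon> * (\<Sum>k\<in>X. ?U (?\<tau> k)) + 2 * \<epsilon> * (\<Sum>k\<in>X. ?G (?\<tau> k))"
    by (simp add: sum.distrib sum_distrib_left)
  also have "\<dots> \<le> 2 / \<epsilon> * (L2norm (grid_measure \<epsilon>) (on_edges \<epsilon> u))\<^sup>2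
      + 2 * \<epsilon> * (L2norm (grid_measure \<epsilon>) (grid_deriv \<epsilon> u))\<^sup>2"
    using \<epsilon>
    by (intro add_mono mult_left_mono sum_edges_le_of_nn_integral[OF nn_integral_edge_norm[OF u] _ _ X \<tau>]
        sum_edges_le_of_nn_integral[OF nn_integral_edge_deriv_norm[OF u] _ _ X \<tau>]) auto
  finally show ?thesis .
qed

section \<open>The two inequalities on the grid\<close>

lemma edge_deriv_norm_le:
  assumes "u \<in> H1_grid \<epsilon>" "e \<in> grid_edges \<epsilon>"
  shows "edge_deriv_norm \<epsilon> u e \<le> L2norm (grid_measure \<epsilon>) (grid_deriv \<epsilon> u)"
proof (rule power2_le_imp_le)
  show "(edge_deriv_norm \<epsilon> u e)\<^sup>2 \<le> (L2norm (grid_measure \<epsilon>) (grid_deriv \<epsilon> u))\<^sup>2"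
    using sum_edges_le_of_nn_integral[OF nn_integral_edge_deriv_norm[OF assms(1)], of "{e}" id] assms(2)
    by simp
qed (rule L2norm_nonneg)

text \<open>Stated for finite \<open>F\<close> because the infinite sum in \<open>ennreal\<close> is
  the supremum of its finite partial sums.\<close>

lemma grid_vertex_sobolev:
  fixes u :: "real ^ 'n \<Rightarrow> real"
  assumes d: "CARD('n) \<ge> 3" and \<epsilon>: "0 < \<epsilon>" and u: "u \<in> H1_grid \<epsilon>"
    and F: "finite F" "F \<subseteq> grid_vertices \<epsilon>"
  defines "p \<equiv> critical_exponent CARD('n)"
  shows "(\<Sum>v\<in>F. \<bar>u v\<bar> powr p) \<le> lattice_sobolev_const CARD('n)
    * (\<epsilon> powr (1/2) * L2norm (grid_measure \<epsilon>) (grid_deriv \<epsilon> u)) powr p"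
proof -
  let ?N = "L2norm (grid_measure \<epsilon>) (grid_deriv \<epsilon> u)"
  obtain X where X: "finite X" "F = lattice_vertex \<epsilon> ` X"
    using F(2) range_lattice_vertex[of \<epsilon>] finite_subset_image[OF F(1), of "lattice_vertex \<epsilon>" UNIV]
    by metis
  have "(\<Sum>v\<in>F. \<bar>u v\<bar> powr p) = (\<Sum>k\<in>X. \<bar>u (lattice_vertex \<epsilon> k)\<bar> powr p)"
    unfolding X(2) using inj_lattice_vertex[of \<epsilon>] \<epsilon> by (subst sum.reindex) (auto intro: inj_on_subset)
  also have "\<dots> \<le> lattice_sobolev_const CARD('n) * (\<epsilon> * ?N\<^sup>2) powr (p / 2)"
    unfolding p_def
    using \<epsilon> by (intro lattice_sobolev[OF d lattice_restriction_square_summable[OF \<epsilon> u]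
          lattice_energy_restriction_le[OF \<epsilon> u] _ X(1)]) auto
  also have "\<epsilon> * ?N\<^sup>2 = (\<epsilon> powr (1/2) * ?N) powr 2"
    using \<epsilon> L2norm_nonneg[of "grid_measure \<epsilon>" "grid_deriv \<epsilon> u"]
    by (simp add: power_mult_distrib powr_half_sqrt)
  finally show ?thesis by (simp only: powr_powr) simp
qed

text \<open>The first summand bounds vertex values, by the sum bound for a single vertex and a
  \<open>p\<close>-th root. The second is the oscillation over a distance of at most
  \<open>\<epsilon> / 2\<close>, from \<open>sqrt (\<epsilon> / 2)\<close>.\<close>

lemma grid_sup_bound:
  fixes u :: "real ^ 'n \<Rightarrow> real"
  assumes d: "CARD('n) \<ge> 3" and \<epsilon>: "0 < \<epsilon>" and u: "u \<in> H1_grid \<epsilon>"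
    and e: "e \<in> grid_edges \<epsilon>" and t: "t \<in> {0..\<epsilon>}"
  shows "\<bar>u (edge_point \<epsilon> e t)\<bar>
    \<le> (lattice_sobolev_const CARD('n) powr (1 / critical_exponent CARD('n)) + 2 powr (-1/2))
      * \<epsilon> powr (1/2) * L2norm (grid_measure \<epsilon>) (grid_deriv \<epsilon> u)"
proof -
  let ?C = "lattice_sobolev_const CARD('n)" and ?p = "critical_exponent CARD('n)"
  let ?N = "L2norm (grid_measure \<epsilon>) (grid_deriv \<epsilon> u)"
  have p0: "?p > 0" using d by (simp add: critical_exponent_def)
  have C0: "?C \<ge> 0" by (simp add: lattice_sobolev_const_def Let_def)
  have N0: "?N \<ge> 0" by (rule L2norm_nonneg)
  have vertex: "\<bar>u v\<bar> \<le> ?C powr (1 / ?p) * (\<epsilon> powr (1/2) * ?N)" if "v \<in> grid_vertices \<epsilon>" for v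
  proof -
    have "\<bar>u v\<bar> powr ?p \<le> ?C * (\<epsilon> powr (1/2) * ?N) powr ?p"
      using grid_vertex_sobolev[OF d \<epsilon> u, of "{v}"] that by simp
    then have "(\<bar>u v\<bar> powr ?p) powr (1 / ?p) \<le> (?C * (\<epsilon> powr (1/2) * ?N) powr ?p) powr (1 / ?p)"
      using p0 by (intro powr_mono2) auto
    then show ?thesis using p0 C0 N0 by (simp add: powr_powr powr_mult)
  qed
  have half: "sqrt (\<epsilon> / 2) = 2 powr (-1/2) * \<epsilon> powr (1/2)"
    using \<epsilon> by (simp add: powr_minus powr_half_sqrt real_sqrt_divide field_simps)
  have osc: "sqrt s * edge_deriv_norm \<epsilon> u e \<le> 2 powr (-1/2) * \<epsilon> powr (1/2) * ?N"
    if "s \<le> \<epsilon> / 2" for s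
  proof -
    have "sqrt s * edge_deriv_norm \<epsilon> u e \<le> sqrt (\<epsilon> / 2) * ?N"
      using that edge_deriv_norm_le[OF u e] \<epsilon>
      by (intro mult_mono) (auto simp: edge_deriv_norm_def L2norm_nonneg)
    then show ?thesis by (simp only: half)
  qed
  have ends: "fst e \<in> grid_vertices \<epsilon>" "snd e \<in> grid_vertices \<epsilon>"
    using e by (auto simp: grid_edges_def)
  \<comment> \<open>The nearer end of the edge is chosen.\<close>
  have "\<exists>v\<in>grid_vertices \<epsilon>. \<bar>u (edge_point \<epsilon> e t) - u v\<bar> \<le> 2 powr (-1/2) * \<epsilon> powr (1/2) * ?N"
  proof (cases "t \<le> \<epsilon> / 2")
    case True
    have "\<bar>u (edge_point \<epsilon> e t) - u (fst e)\<bar> \<le> sqrt (t - 0) * edge_deriv_norm \<epsilon> u e"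
      using edge_oscillation_bound[OF \<epsilon> e u, of 0 t] t by (simp add: edge_point_ends)
    also have "\<dots> \<le> 2 powr (-1/2) * \<epsilon> powr (1/2) * ?N" using True by (intro osc) simp
    finally show ?thesis using ends by blast
  next
    case False
    have "\<bar>u (edge_point \<epsilon> e t) - u (snd e)\<bar> \<le> sqrt (\<epsilon> - t) * edge_deriv_norm \<epsilon> u e"
      using edge_oscillation_bound[OF \<epsilon> e u, of t \<epsilon>] t \<epsilon>
      by (simp add: edge_point_ends abs_minus_commute)
    also have "\<dots> \<le> 2 powr (-1/2) * \<epsilon> powr (1/2) * ?N" using False by (intro osc) simp
    finally show ?thesis using ends by blast
  qed
  then obtain v where "v \<in> grid_vertices \<epsilon>"
    "\<bar>u (edge_point \<epsilon> e t) - u v\<bar> \<le> 2 powr (-1/2) * \<epsilon> powr (1/2) * ?N" by blast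
  then have "\<bar>u (edge_point \<epsilon> e t)\<bar>
      \<le> ?C powr (1 / ?p) * (\<epsilon> powr (1/2) * ?N) + 2 powr (-1/2) * \<epsilon> powr (1/2) * ?N"
    using vertex[of v] by linarith
  then show ?thesis by (simp only: distrib_right mult.assoc)
qed

theorem lemma2p5:
  assumes "CARD('n::finite) \<ge> 3"
  defines "p \<equiv> critical_exponent CARD('n)"
  shows "\<exists>C>0. \<forall>\<epsilon>>0.
    (\<forall>u \<in> (H1_grid \<epsilon> :: (real ^ 'n \<Rightarrow> real) set).
       (\<Sum>\<^sub>\<infinity>v\<in>grid_vertices \<epsilon>. ennreal (\<bar>u v\<bar> powr p))
         \<le> ennreal (C * (\<epsilon> powr (1/2) * L2norm (grid_measure \<epsilon>) (grid_deriv \<epsilon> u)) powr p)) \<and>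
    (\<forall>u \<in> (H1_grid \<epsilon> :: (real ^ 'n \<Rightarrow> real) set).
       Linf_norm (grid_measure \<epsilon>) (on_edges \<epsilon> u)
         \<le> ennreal ((C powr (1/p) + 2 powr (-1/2)) * \<epsilon> powr (1/2)
                     * L2norm (grid_measure \<epsilon>) (grid_deriv \<epsilon> u)))"
proof (intro exI conjI allI impI ballI)
  show "0 < lattice_sobolev_const CARD('n)"
    by (simp add: lattice_sobolev_const_def Let_def)
next
  fix \<epsilon> :: real and u :: "real ^ 'n \<Rightarrow> real"
  assume \<epsilon>: "0 < \<epsilon>" and u: "u \<in> H1_grid \<epsilon>"
  show "(\<Sum>\<^sub>\<infinity>v\<in>grid_vertices \<epsilon>. ennreal (\<bar>u v\<bar> powr p))
      \<le> ennreal (lattice_sobolev_const CARD('n)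
          * (\<epsilon> powr (1/2) * L2norm (grid_measure \<epsilon>) (grid_deriv \<epsilon> u)) powr p)"
    using grid_vertex_sobolev[OF assms(1) \<epsilon> u, folded p_def]
    by (subst nonneg_infsum_complete) (auto intro!: SUP_least ennreal_leI simp: sum_ennreal)
next
  fix \<epsilon> :: real and u :: "real ^ 'n \<Rightarrow> real"
  assume \<epsilon>: "0 < \<epsilon>" and u: "u \<in> H1_grid \<epsilon>"
  show "Linf_norm (grid_measure \<epsilon>) (on_edges \<epsilon> u)
      \<le> ennreal ((lattice_sobolev_const CARD('n) powr (1/p) + 2 powr (-1/2)) * \<epsilon> powr (1/2)
          * L2norm (grid_measure \<epsilon>) (grid_deriv \<epsilon> u))"
    unfolding Linf_norm_def
  proof (rule esssup_I)
    have "on_edges \<epsilon> u \<in> borel_measurable (grid_measure \<epsilon>)"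
      using u by (simp add: H1_grid_def sq_integrable_def)
    then show "(\<lambda>x. ennreal \<bar>on_edges \<epsilon> u x\<bar>) \<in> borel_measurable (grid_measure \<epsilon>)" by simp
    show "AE x in grid_measure \<epsilon>. ennreal \<bar>on_edges \<epsilon> u x\<bar>
        \<le> ennreal ((lattice_sobolev_const CARD('n) powr (1/p) + 2 powr (-1/2)) * \<epsilon> powr (1/2)
          * L2norm (grid_measure \<epsilon>) (grid_deriv \<epsilon> u))"
      \<comment> \<open>The bound holds at every point of the product space, hence almost
        everywhere.\<close>
      unfolding p_def using grid_sup_bound[OF assms(1) \<epsilon> u]
      by (intro AE_I2 ennreal_leI)
        (auto simp: grid_measure_def on_edges_def space_pair_measure)
  qed
qed

end
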